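(* Let $\mathcal{X}=(X_1,\dots,X_g)$ and $\mathcal{Y}=(Y_1,\dots,Y_g)$ be $g$-tuples of square complex matrices (the $X_j$ all of size $k\times k$, the $Y_j$ all of size $k'\times k'$). For each nonnegative integer $n$, $$\lim_{d\to\infty}\frac{1}{(n!)^2}\sum_{|\alpha|=n}\binom{n}{\alpha}^2\sum_{\sigma,\tau\in S_n}\mathrm{sgn}(\sigma)\,\mathrm{sgn}(\tau)\,p_{\sigma,\alpha}(\mathcal{X})\,\overline{p_{\tau,\alpha}(\mathcal{Y})}\int_{U(d)^g}p_{\sigma,\alpha}(\mathcal{U})\,\overline{p_{\tau,\alpha}(\mathcal{U})}\,d\mathcal{U}$$ $$=\frac{1}{n!}\sum_{|\alpha|=n}\binom{n}{\alpha}\sum_{\sigma\in S_n}p_{\sigma,\alpha}(\mathcal{X})\,\overline{p_{\sigma,\alpha}(\mathcal{Y})}.$$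
   Context: $U(d)$ is the $d\times d$ unitary group with normalized Haar probability measure, and $d\mathcal{U}=dU_1\times\cdots\times dU_g$ on $U(d)^g$, $\mathcal{U}=(U_1,\dots,U_g)$. Sums over $\alpha$ run over multi-indices $\alpha=(\alpha_1,\dots,\alpha_g)$ of nonnegative integers with $|\alpha|=\alpha_1+\cdots+\alpha_g=n$, and $\binom{n}{\alpha}=\frac{n!}{\alpha_1!\cdots\alpha_g!}$. $S_n$ is the symmetric group. For a $g$-tuple $\mathcal{A}=(A_1,\dots,A_g)$ of $m\times m$ matrices, $\mathcal{A}^{\otimes\alpha}=A_1^{\otimes\alpha_1}\otimes\cdots\otimes A_g^{\otimes\alpha_g}$ acting on $(\mathbb{C}^m)^{\otimes n}$; $\rho_{S_n}^m(\sigma)$ is the operator on $(\mathbb{C}^m)^{\otimes n}$ given by $v_1\otimes\cdots\otimes v_n\mapsto v_{\sigma^{-1}(1)}\otimes\cdots\otimes v_{\sigma^{-1}(n)}$; and $p_{\sigma,\alpha}(\mathcal{A})=\mathrm{tr}\big(\rho_{S_n}^m(\sigma^{-1})\,\mathcal{A}^{\otimes\alpha}\big)$. *)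

theory Defs
  imports
    "HOL-Probability.Probability"
    "HOL-Combinatorics.Permutations"
    "Jordan_Normal_Form.Schur_Decomposition"
begin

(* "$" below is the entry of a Jordan_Normal_Form vector. *)
unbundle no vec_syntax

section \<open>The unitary group and its Haar probability measure\<close>

definition unitary_mats :: "nat \<Rightarrow> complex mat set" where
  "unitary_mats d =
     {U \<in> carrier_mat d d. U * mat_adjoint U = 1\<^sub>m d \<and> mat_adjoint U * U = 1\<^sub>m d}"

text \<open>
  The type of matrices of unspecified size carries no topology.  The Borel sets of U(d), as a
  subspace of the d*d-dimensional complex space, are pulled back along the tuple of entries.
\<close>
definition borel_unitary :: "nat \<Rightarrow> complex mat measure" where
  "borel_unitary d =
     vimage_algebra (unitary_mats d) (\<lambda>U. \<lambda>ij\<in>{..<d} \<times> {..<d}. U $$ ij)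
       (PiM ({..<d} \<times> {..<d}) (\<lambda>_. borel))"

definition is_haar_unitary :: "nat \<Rightarrow> complex mat measure \<Rightarrow> bool" where
  "is_haar_unitary d \<mu> \<longleftrightarrow>
     prob_space \<mu> \<and> sets \<mu> = sets (borel_unitary d) \<and>
     (\<forall>V\<in>unitary_mats d. \<forall>B\<in>sets \<mu>. emeasure \<mu> ((\<lambda>U. V * U) ` B) = emeasure \<mu> B)"

section \<open>Tensor products\<close>

text \<open>
  The n-fold tensor power of the m-dimensional complex space has dimension \<open>m ^ n\<close>.  Its basis
  vectors are numbered lexicographically, the leftmost tensor factor being the most significant
  one.  Permuted positions and tuple indices start at 0.
\<close>

definition tensor_vec :: "complex vec \<Rightarrow> complex vec \<Rightarrow> complex vec" where
  "tensor_vec v w =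
     vec (dim_vec v * dim_vec w) (\<lambda>i. v $ (i div dim_vec w) * w $ (i mod dim_vec w))"

definition tensor_vecs :: "complex vec list \<Rightarrow> complex vec" where
  "tensor_vecs vs = foldr tensor_vec vs (vec 1 (\<lambda>_. 1))"

definition tensor_mat :: "complex mat \<Rightarrow> complex mat \<Rightarrow> complex mat" where
  "tensor_mat A B =
     mat (dim_row A * dim_row B) (dim_col A * dim_col B)
       (\<lambda>(i, j). A $$ (i div dim_row B, j div dim_col B) * B $$ (i mod dim_row B, j mod dim_col B))"

definition tensor_mats :: "complex mat list \<Rightarrow> complex mat" where
  "tensor_mats As = foldr tensor_mat As (1\<^sub>m 1)"

definition tensor_power_mi :: "nat \<Rightarrow> (nat \<Rightarrow> complex mat) \<Rightarrow> (nat \<Rightarrow> nat) \<Rightarrow> complex mat" where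
  "tensor_power_mi g A \<alpha> = tensor_mats (concat (map (\<lambda>j. replicate (\<alpha> j) (A j)) [0..<g]))"

text \<open>
  The basis vector of number i is the tensor product, over \<open>t < n\<close>, of the unit vectors of
  numbers \<open>tensor_digit m n i t\<close>.
\<close>
definition tensor_digit :: "nat \<Rightarrow> nat \<Rightarrow> nat \<Rightarrow> nat \<Rightarrow> nat" where
  "tensor_digit m n i t = i div m ^ (n - Suc t) mod m"

text \<open>
  The qualified \<open>Hilbert_Choice.inv\<close> avoids a clash with the syntax for inverses in HOL-Algebra.
  The action on pure tensors is lemma \<open>perm_op_tensor_vecs\<close> below.
\<close>
definition perm_op :: "nat \<Rightarrow> nat \<Rightarrow> (nat \<Rightarrow> nat) \<Rightarrow> complex mat" where
  "perm_op m n \<sigma> =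
     mat (m ^ n) (m ^ n)
       (\<lambda>(i, j). if \<forall>t<n. tensor_digit m n i t = tensor_digit m n j (Hilbert_Choice.inv \<sigma> t)
                 then 1 else 0)"

definition mat_tr :: "complex mat \<Rightarrow> complex" where
  "mat_tr A = (\<Sum>i<dim_row A. A $$ (i, i))"

definition trace_poly ::
    "nat \<Rightarrow> nat \<Rightarrow> (nat \<Rightarrow> nat) \<Rightarrow> (nat \<Rightarrow> nat) \<Rightarrow> (nat \<Rightarrow> complex mat) \<Rightarrow> complex" where
  "trace_poly m g \<sigma> \<alpha> A =
     mat_tr (perm_op m (\<Sum>j<g. \<alpha> j) (Hilbert_Choice.inv \<sigma>) * tensor_power_mi g A \<alpha>)"

section \<open>Multi-indices\<close>

definition multi_indices :: "nat \<Rightarrow> nat \<Rightarrow> (nat \<Rightarrow> nat) set" where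
  "multi_indices g n = {\<alpha> \<in> {..<g} \<rightarrow>\<^sub>E UNIV. (\<Sum>j<g. \<alpha> j) = n}"

definition multinom :: "nat \<Rightarrow> nat \<Rightarrow> (nat \<Rightarrow> nat) \<Rightarrow> complex" where
  "multinom g n \<alpha> = fact n / (\<Prod>j<g. fact (\<alpha> j))"

section \<open>Action of the operators on pure tensors\<close>

lemma dim_tensor_vecs:
  assumes "\<And>v. v \<in> set vs \<Longrightarrow> dim_vec v = m"
  shows "dim_vec (tensor_vecs vs) = m ^ length vs"
  using assms by (induction vs) (auto simp: tensor_vecs_def tensor_vec_def)

lemma tensor_digit_less: "i < m ^ n \<Longrightarrow> t < n \<Longrightarrow> tensor_digit m n i t < m"
  by (cases m) (auto simp: tensor_digit_def power_0_left)

lemma tensor_digit_0: "i < m ^ Suc n \<Longrightarrow> tensor_digit m (Suc n) i 0 = i div m ^ n"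
  by (simp add: tensor_digit_def less_mult_imp_div_less)

lemma tensor_digit_Suc:
  assumes "t < n"
  shows "tensor_digit m (Suc n) i (Suc t) = tensor_digit m n (i mod m ^ n) t"
proof -
  have "m ^ n = m ^ ((n - Suc t) + Suc t)"
    using assms by simp
  then have e: "m ^ n = m ^ (n - Suc t) * (m * m ^ t)"
    by (simp only: power_add power_Suc)
  have "(i mod m ^ n) div m ^ (n - Suc t) = (i div m ^ (n - Suc t)) mod (m * m ^ t)"
    unfolding e by (cases "m = 0") (auto simp: mod_mult2_eq power_0_left)
  then show ?thesis
    by (simp add: tensor_digit_def mod_mod_cancel)
qed

lemma tensor_vecs_index:
  assumes "\<And>v. v \<in> set vs \<Longrightarrow> dim_vec v = m" "i < m ^ length vs"
  shows "tensor_vecs vs $ i = (\<Prod>t<length vs. vs ! t $ tensor_digit m (length vs) i t)"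
  using assms
proof (induction vs arbitrary: i)
  case Nil
  then show ?case by (simp add: tensor_vecs_def)
next
  case (Cons v vs)
  have d: "dim_vec (tensor_vecs vs) = m ^ length vs" "dim_vec v = m"
    using Cons.prems dim_tensor_vecs[of vs m] by auto
  have pos: "i mod m ^ length vs < m ^ length vs"
    using Cons.prems by (cases m) (auto simp: power_0_left)
  have "tensor_vecs (v # vs) $ i = v $ (i div m ^ length vs) * tensor_vecs vs $ (i mod m ^ length vs)"
    using Cons.prems d by (simp add: tensor_vecs_def tensor_vec_def)
  also have "\<dots> = v $ (i div m ^ length vs) *
      (\<Prod>t<length vs. vs ! t $ tensor_digit m (length vs) (i mod m ^ length vs) t)"
    using Cons pos by auto
  also have "\<dots> = (\<Prod>t<length (v # vs). (v # vs) ! t $ tensor_digit m (length (v # vs)) i t)"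
    using Cons.prems(2)
    by (simp only: length_Cons prod.lessThan_Suc_shift)
       (simp add: tensor_digit_0[simplified] tensor_digit_Suc)
  finally show ?case .
qed

lemma tensor_digits_inj:
  assumes "i < m ^ n" "j < m ^ n" "\<And>t. t < n \<Longrightarrow> tensor_digit m n i t = tensor_digit m n j t"
  shows "i = j"
  using assms
proof (induction n arbitrary: i j)
  case (Suc n)
  have m: "m ^ n > 0" using Suc.prems(1) by (cases m) auto
  have "i mod m ^ n = j mod m ^ n"
  proof (rule Suc.IH)
    fix t assume "t < n"
    then show "tensor_digit m n (i mod m ^ n) t = tensor_digit m n (j mod m ^ n) t"
      using Suc.prems(3)[of "Suc t"] by (simp add: tensor_digit_Suc)
  qed (use m in simp_all)
  moreover have "i div m ^ n = j div m ^ n"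
    using Suc.prems(3)[of 0] Suc.prems(1,2) by (simp add: tensor_digit_0[simplified])
  ultimately show ?case by (metis div_mult_mod_eq)
qed auto

lemma tensor_digits_surj:
  assumes "\<And>t. t < n \<Longrightarrow> f t < m"
  shows "\<exists>i<m ^ n. \<forall>t<n. tensor_digit m n i t = f t"
  using assms
proof (induction n arbitrary: f)
  case (Suc n)
  obtain i where i: "i < m ^ n" "\<forall>t<n. tensor_digit m n i t = f (Suc t)"
    using Suc.IH[of "\<lambda>t. f (Suc t)"] Suc.prems[of "Suc _"] by (metis Suc_less_eq)
  let ?i = "f 0 * m ^ n + i"
  have "f 0 < m" using Suc.prems by auto
  then have "Suc (f 0) * m ^ n \<le> m * m ^ n" by (intro mult_right_mono) auto
  with i have l: "?i < m ^ Suc n" by simp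
  moreover have "tensor_digit m (Suc n) ?i t = f t" if "t < Suc n" for t
  proof (cases t)
    case 0
    have "m ^ n \<noteq> 0" using i(1) by linarith
    then have "?i div m ^ n = f 0"
      using i(1) div_mult_self3[of "m ^ n" "f 0" i] by simp
    with 0 tensor_digit_0[OF l] show ?thesis by simp
  next
    case (Suc s)
    with i that show ?thesis by (simp add: tensor_digit_Suc)
  qed
  ultimately show ?case by blast
qed auto

lemma perm_op_tensor_vecs:
  assumes \<sigma>: "\<sigma> permutes {..<n}" and v: "\<And>t. t < n \<Longrightarrow> dim_vec (v t) = m"
  shows "perm_op m n \<sigma> *\<^sub>v tensor_vecs (map v [0..<n]) =
         tensor_vecs (map (\<lambda>t. v (Hilbert_Choice.inv \<sigma> t)) [0..<n])"
proof (rule eq_vecI)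
  let ?\<rho> = "Hilbert_Choice.inv \<sigma>"
  have \<rho>: "?\<rho> permutes {..<n}" using \<sigma> by (rule permutes_inv)
  have \<rho>n: "?\<rho> t < n" if "t < n" for t using permutes_in_image[OF \<rho>, of t] that by simp
  have \<sigma>n: "\<sigma> t < n" if "t < n" for t using permutes_in_image[OF \<sigma>, of t] that by simp
  have v1: "dim_vec w = m" if "w \<in> set (map v [0..<n])" for w
    using that v by auto
  have v2: "dim_vec w = m" if "w \<in> set (map (\<lambda>t. v (?\<rho> t)) [0..<n])" for w
    using that v \<rho>n by auto
  have d: "dim_vec (tensor_vecs (map v [0..<n])) = m ^ n"
    "dim_vec (tensor_vecs (map (\<lambda>t. v (?\<rho> t)) [0..<n])) = m ^ n"
    using dim_tensor_vecs[of "map v [0..<n]" m, OF v1]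
      dim_tensor_vecs[of "map (\<lambda>t. v (?\<rho> t)) [0..<n]" m, OF v2] by simp_all
  show "dim_vec (perm_op m n \<sigma> *\<^sub>v tensor_vecs (map v [0..<n])) =
        dim_vec (tensor_vecs (map (\<lambda>t. v (?\<rho> t)) [0..<n]))"
    using d by (simp add: perm_op_def)
  fix i assume "i < dim_vec (tensor_vecs (map (\<lambda>t. v (?\<rho> t)) [0..<n]))"
  then have i: "i < m ^ n" using d by simp
  obtain j where j: "j < m ^ n" "\<forall>t<n. tensor_digit m n j t = tensor_digit m n i (\<sigma> t)"
    using tensor_digits_surj[of n "\<lambda>t. tensor_digit m n i (\<sigma> t)" m, OF tensor_digit_less[OF i \<sigma>n]]
    by blast
  have iff: "(\<forall>t<n. tensor_digit m n i t = tensor_digit m n j' (?\<rho> t)) \<longleftrightarrow> j' = j"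
    if "j' < m ^ n" for j'
  proof
    assume a: "\<forall>t<n. tensor_digit m n i t = tensor_digit m n j' (?\<rho> t)"
    show "j' = j"
    proof (rule tensor_digits_inj[OF that j(1)])
      fix t assume "t < n"
      then show "tensor_digit m n j' t = tensor_digit m n j t"
        using a[rule_format, OF \<sigma>n] j(2) permutes_inverses(2)[OF \<sigma>] by simp
    qed
  next
    assume "j' = j"
    then show "\<forall>t<n. tensor_digit m n i t = tensor_digit m n j' (?\<rho> t)"
      by (simp add: j(2)[rule_format, OF \<rho>n] permutes_inverses(1)[OF \<sigma>])
  qed
  have "(perm_op m n \<sigma> *\<^sub>v tensor_vecs (map v [0..<n])) $ i =
      (\<Sum>j'<m ^ n. perm_op m n \<sigma> $$ (i, j') * tensor_vecs (map v [0..<n]) $ j')"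
    using i d by (auto simp: perm_op_def scalar_prod_def lessThan_atLeast0 intro!: sum.cong)
  also have "\<dots> = (\<Sum>j'<m ^ n. if j' = j then tensor_vecs (map v [0..<n]) $ j' else 0)"
    using i iff by (intro sum.cong) (auto simp: perm_op_def)
  also have "\<dots> = tensor_vecs (map v [0..<n]) $ j"
    using j(1) by simp
  also have "\<dots> = (\<Prod>t<n. v t $ tensor_digit m n j t)"
    using tensor_vecs_index[of "map v [0..<n]" m j, OF v1] j(1) by simp
  also have "\<dots> = (\<Prod>t<n. v t $ tensor_digit m n i (\<sigma> t))"
    using j(2) by auto
  also have "\<dots> = (\<Prod>t<n. v (?\<rho> t) $ tensor_digit m n i t)"
    by (subst prod.permute[OF \<sigma>]) (simp add: permutes_inverses(2)[OF \<sigma>])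
  also have "\<dots> = tensor_vecs (map (\<lambda>t. v (?\<rho> t)) [0..<n]) $ i"
    using tensor_vecs_index[of "map (\<lambda>t. v (?\<rho> t)) [0..<n]" m i, OF v2] i by simp
  finally show "(perm_op m n \<sigma> *\<^sub>v tensor_vecs (map v [0..<n])) $ i =
      tensor_vecs (map (\<lambda>t. v (?\<rho> t)) [0..<n]) $ i" .
qed

end

theory Submission
  imports Defs
begin

text \<open>
  Let \<open>P\<close> be the group of permutations of the n tensor positions that preserve the colouring of the
  positions by \<open>1, \<dots>, g\<close> given by \<open>\<alpha>\<close>.  The claim reduces to the asymptotic orthogonality
  relation that the expectation of \<open>p\<^sub>\<sigma> cnj p\<^sub>\<tau>\<close> tends to the number of \<open>\<pi> \<in> P\<close> with
  \<open>\<sigma> \<pi> = \<pi> \<tau>\<close>: such \<open>\<pi>\<close> force \<open>sgn \<sigma> = sgn \<tau>\<close> and \<open>p\<^sub>\<tau>(Y) = p\<^sub>\<sigma>(Y)\<close>, and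
  \<open>multinom * card P = n!\<close>.

  For fixed column indices, the moments of matrix entries are functions \<open>F a c\<close> of the row indices of
  the entries and of the conjugated entries.  Differentiating the invariance of Haar measure under
  rotations in a coordinate plane gives an exchange relation: when q is a fresh value, replacing
  \<open>c s\<close> by q and summing over the ways to replace an equal entry of \<open>a\<close> of the same colour by q
  does not change the moment.  Iterating it moves \<open>c\<close> to a fixed injective tuple, so
  \<open>F a c\<close> is a sum of weights \<open>f \<pi>\<close> over the \<open>\<pi> \<in> P\<close> with \<open>a \<circ> \<pi> = c\<close>.  Orthonormality of the
  columns turns into a linear system for the weights whose matrix, divided by \<open>d ^ n\<close>, is the identity up
  to \<open>O(1/d)\<close>; hence so is its solution.
\<close>

section \<open>Unitary matrices and invariance of Haar measure\<close>

lemma index_mat_adjoint: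
  assumes "A \<in> carrier_mat m n" "i < n" "j < m"
  shows "mat_adjoint A $$ (i, j) = cnj (A $$ (j, i))"
  using assms by (simp add: mat_adjoint_def mat_of_rows_def conjugate_complex_def)

lemma mat_adjoint_carrier: "A \<in> carrier_mat m n \<Longrightarrow> mat_adjoint A \<in> carrier_mat n m"
  by (auto simp: mat_adjoint_def mat_of_rows_def)

lemma mat_adjoint_adjoint:
  assumes "A \<in> carrier_mat m n"
  shows "mat_adjoint (mat_adjoint A) = (A :: complex mat)"
proof (rule eq_matI)
  note a = mat_adjoint_carrier[OF assms]
  fix i j assume "i < dim_row A" "j < dim_col A"
  then show "mat_adjoint (mat_adjoint A) $$ (i, j) = A $$ (i, j)"
    using assms by (simp add: index_mat_adjoint[OF a] index_mat_adjoint[OF assms])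
qed (use assms mat_adjoint_carrier[OF mat_adjoint_carrier[OF assms]] in auto)

lemma index_mult_mat_sum:
  assumes "A \<in> carrier_mat m n" "B \<in> carrier_mat n l" "i < m" "j < l"
  shows "(A * B) $$ (i, j) = (\<Sum>k<n. A $$ (i, k) * B $$ (k, j))"
  using assms by (auto simp: scalar_prod_def lessThan_atLeast0 intro!: sum.cong)

lemma unitary_mats_carrier: "U \<in> unitary_mats d \<Longrightarrow> U \<in> carrier_mat d d"
  by (simp add: unitary_mats_def)

lemma unitary_mats_adjoint: "U \<in> unitary_mats d \<Longrightarrow> mat_adjoint U \<in> unitary_mats d"
  by (auto simp: unitary_mats_def mat_adjoint_adjoint[of U d d] mat_adjoint_carrier)

lemma unitary_mats_columns:
  assumes "U \<in> unitary_mats d" "i < d" "j < d"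
  shows "(\<Sum>k<d. U $$ (k, i) * cnj (U $$ (k, j))) = (if i = j then 1 else 0)"
proof -
  have U: "U \<in> carrier_mat d d" "mat_adjoint U * U = 1\<^sub>m d"
    using assms by (auto simp: unitary_mats_def)
  have "(mat_adjoint U * U) $$ (j, i) = (\<Sum>k<d. U $$ (k, i) * cnj (U $$ (k, j)))"
    using U(1) assms
    by (subst index_mult_mat_sum[OF mat_adjoint_carrier[OF U(1)] U(1)])
       (auto simp: index_mat_adjoint[OF U(1)] intro!: sum.cong)
  then show ?thesis using U assms by auto
qed

text \<open>Orthonormal rows give one of the two defining equations; the other follows because a
  one-sided inverse of a square matrix is two-sided.\<close>

lemma unitary_mats_rows:
  assumes "U \<in> carrier_mat d d"
    "\<And>i j. i < d \<Longrightarrow> j < d \<Longrightarrow> (\<Sum>k<d. U $$ (i, k) * cnj (U $$ (j, k))) = (if i = j then 1 else 0)"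
  shows "U \<in> unitary_mats d"
proof -
  have "U * mat_adjoint U = 1\<^sub>m d"
  proof (rule eq_matI)
    fix i j assume ij: "i < dim_row (1\<^sub>m d :: complex mat)" "j < dim_col (1\<^sub>m d :: complex mat)"
    then have "(U * mat_adjoint U) $$ (i, j) = (\<Sum>k<d. U $$ (i, k) * cnj (U $$ (j, k)))"
      by (subst index_mult_mat_sum[OF assms(1) mat_adjoint_carrier[OF assms(1)]])
         (auto simp: index_mat_adjoint[OF assms(1)] intro!: sum.cong)
    with assms(2) ij show "(U * mat_adjoint U) $$ (i, j) = 1\<^sub>m d $$ (i, j)" by simp
  qed (use assms(1) mat_adjoint_carrier[OF assms(1)] in auto)
  moreover from this have "mat_adjoint U * U = 1\<^sub>m d"
    using mat_mult_left_right_inverse[OF assms(1) mat_adjoint_carrier[OF assms(1)]] by blast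
  ultimately show ?thesis using assms(1) by (simp add: unitary_mats_def)
qed

text \<open>Column j is a unit vector, so no single squared modulus exceeds 1. This bound is what
  makes every product of entries integrable.\<close>

lemma norm_unitary_entry_le:
  assumes "U \<in> unitary_mats d" "i < d" "j < d"
  shows "norm (U $$ (i, j)) \<le> 1"
proof -
  have "(\<Sum>k<d. complex_of_real ((norm (U $$ (k, j)))\<^sup>2)) = complex_of_real 1"
    using unitary_mats_columns[OF assms(1,3,3)] by (simp add: complex_norm_square del: of_real_power)
  then have "(\<Sum>k<d. (norm (U $$ (k, j)))\<^sup>2) = 1"
    unfolding of_real_sum[symmetric] of_real_eq_iff .
  moreover have "(norm (U $$ (i, j)))\<^sup>2 \<le> (\<Sum>k<d. (norm (U $$ (k, j)))\<^sup>2)"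
    using assms(2) by (intro member_le_sum) auto
  ultimately show ?thesis by (simp add: power_le_one_iff abs_square_le_1)
qed

lemma mat_adjoint_mult:
  assumes "A \<in> carrier_mat m n" "B \<in> carrier_mat n l"
  shows "mat_adjoint (A * B) = mat_adjoint B * mat_adjoint (A :: complex mat)"
proof (rule eq_matI)
  note a = mat_adjoint_carrier[OF assms(1)] mat_adjoint_carrier[OF assms(2)]
  have ab: "A * B \<in> carrier_mat m l" using assms by simp
  fix i j assume "i < dim_row (mat_adjoint B * mat_adjoint A)" "j < dim_col (mat_adjoint B * mat_adjoint A)"
  then have ij: "i < l" "j < m" using a by auto
  show "mat_adjoint (A * B) $$ (i, j) = (mat_adjoint B * mat_adjoint A) $$ (i, j)"
    unfolding index_mat_adjoint[OF ab ij] index_mult_mat_sum[OF assms ij(2,1)]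
      index_mult_mat_sum[OF a(2,1) ij] cnj_sum
    using ij by (intro sum.cong) (simp_all add: index_mat_adjoint[OF assms(1)] index_mat_adjoint[OF assms(2)])
qed (use assms mat_adjoint_carrier[of "A * B" m l] mat_adjoint_carrier[OF assms(1)]
      mat_adjoint_carrier[OF assms(2)] in auto)

lemma unitary_mats_mult:
  assumes "U \<in> unitary_mats d" "V \<in> unitary_mats d"
  shows "U * V \<in> unitary_mats d"
proof -
  let ?U = "mat_adjoint U" and ?V = "mat_adjoint V"
  have c: "U \<in> carrier_mat d d" "V \<in> carrier_mat d d" "U * ?U = 1\<^sub>m d" "?U * U = 1\<^sub>m d"
      "V * ?V = 1\<^sub>m d" "?V * V = 1\<^sub>m d"
    using assms by (auto simp: unitary_mats_def)
  note a = mat_adjoint_carrier[OF c(1)] mat_adjoint_carrier[OF c(2)]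
  have "U * V * (?V * ?U) = U * (V * ?V) * ?U"
    using c(1,2) a by (simp add: assoc_mult_mat[of _ d d _ d _ d])
  moreover have "?V * ?U * (U * V) = ?V * (?U * U) * V"
    using c(1,2) a by (simp add: assoc_mult_mat[of _ d d _ d _ d])
  ultimately show ?thesis
    using c a by (simp add: unitary_mats_def mat_adjoint_mult[OF c(1,2)])
qed

section \<open>Rotations in a complex coordinate plane\<close>

definition plane_rotation :: "nat \<Rightarrow> nat \<Rightarrow> nat \<Rightarrow> complex \<Rightarrow> real \<Rightarrow> real \<Rightarrow> complex mat" where
  "plane_rotation d p q z c s = mat d d (\<lambda>(i, j).
     if i = p then (if j = p then of_real c else if j = q then z * of_real s else 0)
     else if i = q then (if j = p then - cnj z * of_real s else if j = q then of_real c else 0)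
     else if i = j then 1 else 0)"

text \<open>With \<open>x\<close> a column of \<open>U\<close> this describes the product with
  \<open>U\<close>; with \<open>x\<close> a conjugated row of a rotation it yields unitarity. On
  rows \<open>p\<close> and \<open>q\<close> the right-hand side already has the shape that
  \<open>rotation_invariance_derivative\<close> expects.\<close>

lemma plane_rotation_row:
  fixes x :: "nat \<Rightarrow> complex"
  assumes "p < d" "q < d" "p \<noteq> q" "i < d"
  shows "(\<Sum>k<d. plane_rotation d p q z c s $$ (i, k) * x k) =
    (if i = p then of_real c * x p + of_real s * (z * x q)
     else if i = q then of_real c * x q + of_real s * (- cnj z * x p) else x i)"
proof -
  \<comment> \<open>Rows \<open>p\<close> and \<open>q\<close> are supported on columns
    \<open>p\<close> and \<open>q\<close>, the other rows on the diagonal, so each summand is a sum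
    of three Kronecker deltas.\<close>
  have "(\<Sum>k<d. plane_rotation d p q z c s $$ (i, k) * x k) =
     (\<Sum>k<d. (if k = p then (if i = p then of_real c * x p else if i = q then of_real s * (- cnj z * x p) else 0) else 0)
      + (if k = q then (if i = p then of_real s * (z * x q) else if i = q then of_real c * x q else 0) else 0)
      + (if k = i then (if i = p then 0 else if i = q then 0 else x i) else 0))"
    using assms by (intro sum.cong refl) (auto simp: plane_rotation_def)
  then show ?thesis using assms by (simp add: sum.distrib)
qed

lemma plane_rotation_unitary:
  assumes "p < d" "q < d" "p \<noteq> q" "norm z = 1" "c\<^sup>2 + s\<^sup>2 = 1"
  shows "plane_rotation d p q z c s \<in> unitary_mats d"
proof (rule unitary_mats_rows)
  show "plane_rotation d p q z c s \<in> carrier_mat d d" by (simp add: plane_rotation_def)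
  have zz: "z * cnj z = 1" using assms(4) by (simp flip: complex_norm_square)
  have cs: "complex_of_real c * of_real c + of_real s * of_real s = 1"
    using assms(5) by (metis of_real_1 of_real_add of_real_mult power2_eq_square)
  fix i j assume ij: "i < d" "j < d"
  have e1: "of_real c * of_real c + z * (cnj z * (of_real s * of_real s)) = 1"
    using cs zz by (metis mult.assoc mult_1)
  show "(\<Sum>k<d. plane_rotation d p q z c s $$ (i, k) * cnj (plane_rotation d p q z c s $$ (j, k))) =
    (if i = j then 1 else 0)"
    using assms ij cs
    by (subst plane_rotation_row[OF assms(1-3) ij(1)])
      (auto simp: plane_rotation_def e1 algebra_simps)
qed

lemma plane_rotation_mult:
  assumes "p < d" "q < d" "p \<noteq> q" "U \<in> carrier_mat d d" "i < d" "j < d"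
  shows "(plane_rotation d p q z c s * U) $$ (i, j) =
    (if i = p then of_real c * U $$ (p, j) + of_real s * (z * U $$ (q, j))
     else if i = q then of_real c * U $$ (q, j) + of_real s * (- cnj z * U $$ (p, j)) else U $$ (i, j))"
proof -
  have "plane_rotation d p q z c s \<in> carrier_mat d d" by (simp add: plane_rotation_def)
  from index_mult_mat_sum[OF this assms(4-6)] show ?thesis
    by (simp only: plane_rotation_row[OF assms(1-3,5)])
qed

section \<open>Measurability of entries and left invariance of integrals\<close>

lemma measurable_entry_borel_unitary:
  assumes "i < d" "j < d"
  shows "(\<lambda>U. U $$ (i, j)) \<in> borel_measurable (borel_unitary d)"
proof -
  let ?P = "PiM ({..<d} \<times> {..<d}) (\<lambda>_. borel :: complex measure)"
  have 1: "(\<lambda>U. \<lambda>ij\<in>{..<d} \<times> {..<d}. U $$ ij) \<in> measurable (borel_unitary d) ?P"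
    unfolding borel_unitary_def by (rule measurable_vimage_algebra1) (auto simp: space_PiM)
  have 2: "(\<lambda>f. f (i, j)) \<in> measurable ?P borel"
    using assms by (intro measurable_component_singleton) auto
  show ?thesis using measurable_compose[OF 1 2] assms by simp
qed

lemma space_borel_unitary: "space (borel_unitary d) = unitary_mats d"
  by (simp add: borel_unitary_def)

text \<open>Measurability into a pulled-back sigma-algebra is measurability of the tuple of entries,
  and each entry of the product is a linear combination of entries of \<open>U\<close>.\<close>

lemma measurable_left_mult_unitary:
  assumes "V \<in> unitary_mats d"
  shows "(\<lambda>U. V * U) \<in> measurable (borel_unitary d) (borel_unitary d)"
proof -
  have V: "V \<in> carrier_mat d d" using assms by (rule unitary_mats_carrier)
  have "(\<lambda>U. \<lambda>ij\<in>{..<d} \<times> {..<d}. (V * U) $$ ij) \<in>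
    measurable (borel_unitary d) (PiM ({..<d} \<times> {..<d}) (\<lambda>_. borel))"
  proof (rule measurable_restrict)
    fix ij assume "ij \<in> {..<d} \<times> {..<d}"
    then obtain i j where ij: "ij = (i, j)" "i < d" "j < d" by auto
    have "(\<lambda>U. \<Sum>k<d. V $$ (i, k) * U $$ (k, j)) \<in> borel_measurable (borel_unitary d)"
      using ij by (intro borel_measurable_sum borel_measurable_times measurable_entry_borel_unitary) auto
    then show "(\<lambda>U. (V * U) $$ ij) \<in> borel_measurable (borel_unitary d)"
      by (subst measurable_cong[where g = "\<lambda>U. \<Sum>k<d. V $$ (i, k) * U $$ (k, j)"])
        (use ij V in \<open>auto simp only: space_borel_unitary index_mult_mat_sum dest!: unitary_mats_carrier\<close>)
  qed
  then show ?thesis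
    using assms unfolding borel_unitary_def
    by (intro measurable_vimage_algebra2) (auto simp: unitary_mats_mult)
qed

text \<open>\<open>is_haar_unitary\<close> speaks of images of sets, whereas a pushforward measures
  preimages. The preimage under left multiplication by \<open>V\<close> is the image under its
  adjoint, which is unitary too; hence the pushforward of \<open>\<mu>\<close> is
  \<open>\<mu>\<close>, and the change of variables formula applies.\<close>

lemma integral_left_mult_haar:
  fixes f :: "complex mat \<Rightarrow> complex"
  assumes haar: "is_haar_unitary d \<mu>" and V: "V \<in> unitary_mats d"
    and f: "f \<in> borel_measurable \<mu>"
  shows "(LINT U|\<mu>. f (V * U)) = (LINT U|\<mu>. f U)"
proof -
  have s: "sets \<mu> = sets (borel_unitary d)" using haar by (simp add: is_haar_unitary_def)
  have sp: "space \<mu> = unitary_mats d"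
    using sets_eq_imp_space_eq[OF s] by (simp add: space_borel_unitary)
  have m: "(\<lambda>U. V * U) \<in> measurable \<mu> \<mu>"
    using measurable_left_mult_unitary[OF V] by (simp cong: measurable_cong_sets add: s)
  have "distr \<mu> \<mu> (\<lambda>U. V * U) = \<mu>"
  proof (rule measure_eqI)
    fix B assume "B \<in> sets (distr \<mu> \<mu> ((*) V))"
    then have B: "B \<in> sets \<mu>" by simp
    have one: "1\<^sub>m d * U = U" if "U \<in> carrier_mat d d" for U :: "complex mat"
      using that by simp
    have inv1: "V * (mat_adjoint V * U) = U" "mat_adjoint V * (V * U) = U" if "U \<in> unitary_mats d" for U
      using V that by (simp_all add: unitary_mats_def mat_adjoint_carrier one
          assoc_mult_mat[symmetric, of _ d d _ d _ d])
    have "(\<lambda>U. V * U) -` B \<inter> space \<mu> = (\<lambda>U. mat_adjoint V * U) ` B"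
    proof (intro equalityI subsetI)
      fix U assume "U \<in> (\<lambda>U. V * U) -` B \<inter> space \<mu>"
      then show "U \<in> (\<lambda>U. mat_adjoint V * U) ` B"
        using inv1(2)[of U] sp by (intro image_eqI[of _ _ "V * U"]) auto
    next
      fix W assume "W \<in> (\<lambda>U. mat_adjoint V * U) ` B"
      then obtain U where U: "U \<in> B" "W = mat_adjoint V * U" by auto
      with B sp have "U \<in> unitary_mats d" using sets.sets_into_space by blast
      with U inv1(1)[of U] sp show "W \<in> (\<lambda>U. V * U) -` B \<inter> space \<mu>"
        by (auto intro: unitary_mats_mult unitary_mats_adjoint V)
    qed
    then show "emeasure (distr \<mu> \<mu> ((*) V)) B = emeasure \<mu> B"
      using haar B unitary_mats_adjoint[OF V] by (simp add: emeasure_distr m is_haar_unitary_def)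
  qed simp
  then show ?thesis using integral_distr[OF m f] by simp
qed

section \<open>The exchange relation for moments of a Haar unitary\<close>

text \<open>To first order in the angle only terms linear in the sine survive. This singles out the
  terms in which exactly one factor is rotated.\<close>

lemma has_real_derivative_cos_sin_powers:
  "((\<lambda>\<theta>::real. cos \<theta> ^ a * sin \<theta> ^ b) has_real_derivative (if b = 1 then 1 else 0)) (at 0)"
proof -
  have "((\<lambda>\<theta>::real. cos \<theta> ^ a * sin \<theta> ^ b) has_real_derivative
      of_nat a * (- sin 0 * cos 0 ^ (a - 1)) * sin 0 ^ b + of_nat b * (cos 0 * sin 0 ^ (b - 1)) * cos 0 ^ a) (at 0)"
    by (auto intro!: derivative_eq_intros)
  then show ?thesis
    by (cases "b = 0 \<or> b = 1") (auto simp: power_0_left)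
qed

lemma (in prob_space) integrable_bounded_by_1:
  fixes f :: "'a \<Rightarrow> complex"
  assumes "f \<in> borel_measurable M" "\<And>x. x \<in> space M \<Longrightarrow> norm (f x) \<le> 1"
  shows "integrable M f"
  using assms by (intro integrable_const_bound[of _ 1]) auto

lemma norm_prod_le_1:
  fixes f :: "'i \<Rightarrow> complex"
  assumes "\<And>i. i \<in> A \<Longrightarrow> norm (f i) \<le> 1"
  shows "norm (prod f A) \<le> 1"
  using assms by (simp flip: prod_norm) (intro prod_le_1, auto)

text \<open>\<open>z\<close> collects the factors that the rotation leaves alone. Multiplying out
  before integrating turns the integral into a trigonometric polynomial in the angle with constant
  coefficients, so the derivative is taken outside the integral; it is 0 because the integral does
  not depend on the angle.\<close>

lemma (in prob_space) rotation_invariance_derivative: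
  fixes x y :: "'i \<Rightarrow> 'a \<Rightarrow> complex" and z :: "'a \<Rightarrow> complex"
  assumes fin: "finite J"
    and meas: "z \<in> borel_measurable M" "\<And>t. t \<in> J \<Longrightarrow> x t \<in> borel_measurable M"
      "\<And>t. t \<in> J \<Longrightarrow> y t \<in> borel_measurable M"
    and bound: "\<And>\<omega>. \<omega> \<in> space M \<Longrightarrow> norm (z \<omega>) \<le> 1"
      "\<And>t \<omega>. t \<in> J \<Longrightarrow> \<omega> \<in> space M \<Longrightarrow> norm (x t \<omega>) \<le> 1"
      "\<And>t \<omega>. t \<in> J \<Longrightarrow> \<omega> \<in> space M \<Longrightarrow> norm (y t \<omega>) \<le> 1"
    and const: "\<And>\<theta>::real. (LINT \<omega>|M. z \<omega> *
      (\<Prod>t\<in>J. of_real (cos \<theta>) * x t \<omega> + of_real (sin \<theta>) * y t \<omega>)) = C"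
  shows "(\<Sum>t\<in>J. LINT \<omega>|M. z \<omega> * (y t \<omega> * (\<Prod>r\<in>J-{t}. x r \<omega>))) = 0"
proof -
  \<comment> \<open>\<open>B\<close> is the set of factors that keep \<open>x\<close>; those outside
    \<open>B\<close> take \<open>y\<close>.\<close>
  define e where "e B \<omega> = z \<omega> * ((\<Prod>t\<in>B. x t \<omega>) * (\<Prod>t\<in>J-B. y t \<omega>))" for B \<omega>
  have int: "integrable M (e B)" if "B \<subseteq> J" for B
  proof (rule integrable_bounded_by_1)
    have "B \<subseteq> J" "J - B \<subseteq> J" using that by auto
    then show "e B \<in> borel_measurable M"
      unfolding e_def using meas by (intro borel_measurable_times borel_measurable_prod) auto
    fix \<omega> assume w: "\<omega> \<in> space M"
    have "norm (\<Prod>t\<in>B. x t \<omega>) \<le> 1" "norm (\<Prod>t\<in>J-B. y t \<omega>) \<le> 1"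
      using that w by (auto intro!: norm_prod_le_1 bound)
    then show "norm (e B \<omega>) \<le> 1"
      unfolding e_def norm_mult using bound(1)[OF w] by (intro mult_le_one) auto
  qed
  have expand: "z \<omega> * (\<Prod>t\<in>J. of_real (cos \<theta>) * x t \<omega> + of_real (sin \<theta>) * y t \<omega>) =
      (\<Sum>B\<in>Pow J. (cos \<theta> ^ card B * sin \<theta> ^ card (J - B)) *\<^sub>R e B \<omega>)" for \<theta> \<omega>
    by (simp add: prod_add[OF fin] sum_distrib_left e_def prod.distrib scaleR_conv_of_real mult_ac)
  have "C = (\<Sum>B\<in>Pow J. (cos \<theta> ^ card B * sin \<theta> ^ card (J - B)) *\<^sub>R integral\<^sup>L M (e B))" for \<theta> :: real
    unfolding const[of \<theta>, symmetric] expand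
    by (subst Bochner_Integration.integral_sum) (auto intro: int)
  then have "((\<lambda>\<theta>::real. \<Sum>B\<in>Pow J. (cos \<theta> ^ card B * sin \<theta> ^ card (J - B)) *\<^sub>R integral\<^sup>L M (e B))
      has_vector_derivative 0) (at 0)"
    by (simp flip: fun_eq_iff)
  moreover have "((\<lambda>\<theta>::real. \<Sum>B\<in>Pow J. (cos \<theta> ^ card B * sin \<theta> ^ card (J - B)) *\<^sub>R integral\<^sup>L M (e B))
      has_vector_derivative (\<Sum>B\<in>Pow J. (if card (J - B) = 1 then 1 else 0) *\<^sub>R integral\<^sup>L M (e B))) (at 0)"
  proof (rule has_vector_derivative_sum)
    fix B
    show "((\<lambda>\<theta>::real. (cos \<theta> ^ card B * sin \<theta> ^ card (J - B)) *\<^sub>R integral\<^sup>L M (e B))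
      has_vector_derivative (if card (J - B) = 1 then 1 else 0) *\<^sub>R integral\<^sup>L M (e B)) (at 0)"
      using has_vector_derivative_scaleR[OF has_real_derivative_cos_sin_powers
          has_vector_derivative_const, of "card B" "card (J - B)" "integral\<^sup>L M (e B)"]
      by simp
  qed
  ultimately have "0 = (\<Sum>B\<in>Pow J. (if card (J - B) = 1 then 1 else 0) *\<^sub>R integral\<^sup>L M (e B))"
    by (rule vector_derivative_unique_at)
  \<comment> \<open>The first-order terms come from the sets \<open>B\<close> that miss exactly one
    element of \<open>J\<close>.\<close>
  also have "\<dots> = (\<Sum>B\<in>(\<lambda>t. J - {t}) ` J. integral\<^sup>L M (e B))"
  proof (rule sum.mono_neutral_cong_right)
    show "\<forall>B\<in>Pow J - (\<lambda>t. J - {t}) ` J. (if card (J - B) = 1 then 1 else 0) *\<^sub>R integral\<^sup>L M (e B) = 0"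
    proof
      fix B assume B: "B \<in> Pow J - (\<lambda>t. J - {t}) ` J"
      have "card (J - B) \<noteq> 1"
      proof
        assume "card (J - B) = 1"
        then obtain t where "J - B = {t}" by (auto simp: card_1_singleton_iff)
        with B show False by blast
      qed
      then show "(if card (J - B) = 1 then 1 else 0) *\<^sub>R integral\<^sup>L M (e B) = 0" by simp
    qed
    fix B assume "B \<in> (\<lambda>t. J - {t}) ` J"
    then obtain t where "t \<in> J" "B = J - {t}" by auto
    then have "J - B = {t}" by auto
    then show "(if card (J - B) = 1 then 1 else 0) *\<^sub>R integral\<^sup>L M (e B) = integral\<^sup>L M (e B)" by simp
  qed (use fin in auto)
  also have "\<dots> = (\<Sum>t\<in>J. integral\<^sup>L M (e (J - {t})))"
    by (subst sum.reindex) (auto simp: inj_on_def)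
  also have "\<dots> = (\<Sum>t\<in>J. LINT \<omega>|M. z \<omega> * (y t \<omega> * (\<Prod>r\<in>J-{t}. x r \<omega>)))"
  proof (rule sum.cong[OF refl])
    fix t assume "t \<in> J"
    then have "J - (J - {t}) = {t}" by auto
    then have "e (J - {t}) = (\<lambda>\<omega>. z \<omega> * (y t \<omega> * (\<Prod>r\<in>J-{t}. x r \<omega>)))"
      by (simp add: e_def fun_eq_iff mult_ac)
    then show "integral\<^sup>L M (e (J - {t})) = (LINT \<omega>|M. z \<omega> * (y t \<omega> * (\<Prod>r\<in>J-{t}. x r \<omega>)))"
      by simp
  qed
  finally show ?thesis by simp
qed

section \<open>Moments of the entries of one Haar unitary\<close>

definition cnj_unless :: "bool \<Rightarrow> complex \<Rightarrow> complex" where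
  "cnj_unless k x = (if k then x else cnj x)"

text \<open>\<open>ri\<close> and \<open>ci\<close> give the row and the column of each slot;
  \<open>k\<close> is true on plain slots and false on conjugated ones. With both kinds in one
  product over a slot set \<open>K\<close>, a rotation acts on all slots uniformly.\<close>

definition haar_moment ::
    "complex mat measure \<Rightarrow> 'i set \<Rightarrow> ('i \<Rightarrow> bool) \<Rightarrow> ('i \<Rightarrow> nat) \<Rightarrow> ('i \<Rightarrow> nat) \<Rightarrow> complex" where
  "haar_moment \<mu> K k ci ri = (LINT U|\<mu>. (\<Prod>t\<in>K. cnj_unless (k t) (U $$ (ri t, ci t))))"

lemma norm_cnj_unless [simp]: "norm (cnj_unless k x) = norm x"
  by (simp add: cnj_unless_def)

lemma space_haar: "is_haar_unitary d \<mu> \<Longrightarrow> space \<mu> = unitary_mats d"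
  using sets_eq_imp_space_eq[of \<mu> "borel_unitary d"]
  by (simp add: is_haar_unitary_def space_borel_unitary)

lemma measurable_cnj_unless_entry:
  assumes "is_haar_unitary d \<mu>" "i < d" "j < d"
  shows "(\<lambda>U. cnj_unless k (U $$ (i, j))) \<in> borel_measurable \<mu>"
proof -
  have s: "sets \<mu> = sets (borel_unitary d)"
    using assms(1) by (simp add: is_haar_unitary_def)
  have m: "(\<lambda>U. U $$ (i, j)) \<in> borel_measurable \<mu>"
    using measurable_entry_borel_unitary[OF assms(2,3)] measurable_cong_sets[OF s refl] by blast
  have "cnj_unless k \<in> borel_measurable borel"
    unfolding cnj_unless_def by (cases k) (auto intro!: borel_measurable_continuous_onI continuous_intros)
  with m show ?thesis by (rule measurable_compose)
qed

text \<open>The difference of the two sides is the coefficient of \<open>z\<close> in the derivative, at angle 0, of the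
  invariance under the rotation with phase \<open>z\<close>; the values \<open>z = 1\<close> and \<open>z = \<i>\<close> separate it from the
  coefficient of \<open>cnj z\<close>.\<close>

lemma haar_moment_exchange:
  assumes haar: "is_haar_unitary d \<mu>" and fin: "finite K"
    and ri: "\<And>t. t \<in> K \<Longrightarrow> ri t < d" and ci: "\<And>t. t \<in> K \<Longrightarrow> ci t < d"
    and pq: "p < d" "q < d" "p \<noteq> q"
  shows "(\<Sum>t | t \<in> K \<and> k t \<and> ri t = p. haar_moment \<mu> K k ci (ri(t := q))) =
         (\<Sum>t | t \<in> K \<and> \<not> k t \<and> ri t = q. haar_moment \<mu> K k ci (ri(t := p)))"
proof -
  interpret prob_space \<mu> using haar by (simp add: is_haar_unitary_def)
  \<comment> \<open>\<open>J\<close> is the set of slots lying in one of the two rotated rows. To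
    first order the rotation moves such a slot to the opposite row \<open>opp t\<close>, with
    coefficient \<open>coef z t\<close>.\<close>
  define J where "J = {t \<in> K. ri t = p \<or> ri t = q}"
  define opp where "opp t = (if ri t = p then q else p)" for t
  define N where "N t = haar_moment \<mu> K k ci (ri(t := opp t))" for t
  define coef where "coef z t = cnj_unless (k t) (if ri t = p then z else - cnj z)" for z t
  define w where "w t U = cnj_unless (k t) (U $$ (ri t, ci t))" for t U
  define v where "v t U = cnj_unless (k t) (U $$ (opp t, ci t))" for t U
  have J: "finite J" "J \<subseteq> K" using fin by (auto simp: J_def)
  have opp: "opp t < d" for t using pq by (simp add: opp_def)
  have rot: "(\<Sum>t\<in>J. coef z t * N t) = 0" if z: "norm z = 1" for z
  proof -
    have "(\<Sum>t\<in>J. LINT U|\<mu>. (\<Prod>r\<in>K-J. w r U) * (coef z t * v t U * (\<Prod>r\<in>J-{t}. w r U))) = 0"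
    proof (rule rotation_invariance_derivative[OF J(1)])
      fix \<theta> :: real
      let ?R = "plane_rotation d p q z (cos \<theta>) (sin \<theta>)"
      have "(LINT U|\<mu>. (\<Prod>r\<in>K. w r (?R * U))) = (LINT U|\<mu>. (\<Prod>r\<in>K. w r U))"
        by (rule integral_left_mult_haar[OF haar])
          (use ri ci haar z pq in \<open>auto simp: w_def intro!: borel_measurable_prod
             measurable_cnj_unless_entry plane_rotation_unitary\<close>)
      moreover have "(\<Prod>r\<in>K. w r (?R * U)) = (\<Prod>r\<in>K-J. w r U) *
          (\<Prod>t\<in>J. of_real (cos \<theta>) * w t U + of_real (sin \<theta>) * (coef z t * v t U))"
        if "U \<in> space \<mu>" for U
      proof -
        have U: "U \<in> carrier_mat d d" using that space_haar[OF haar] unitary_mats_carrier by auto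
        have 1: "w r (?R * U) = w r U" if "r \<in> K - J" for r
          using that ri ci by (simp add: w_def J_def plane_rotation_mult[OF pq U])
        have 2: "w t (?R * U) = of_real (cos \<theta>) * w t U + of_real (sin \<theta>) * (coef z t * v t U)"
          if "t \<in> J" for t
        proof -
          have "ri t < d" "ci t < d" "ri t = p \<or> ri t = q"
            using that ri ci by (auto simp: J_def)
          then show ?thesis using pq
            by (auto simp: w_def v_def coef_def opp_def plane_rotation_mult[OF pq U] cnj_unless_def)
        qed
        have "(\<Prod>r\<in>K. w r (?R * U)) = (\<Prod>r\<in>K-J. w r (?R * U)) * (\<Prod>r\<in>J. w r (?R * U))"
          using prod.subset_diff[OF J(2) fin] .
        with 1 2 show ?thesis by simp
      qed
      ultimately show "(LINT U|\<mu>. (\<Prod>r\<in>K-J. w r U) *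
          (\<Prod>t\<in>J. of_real (cos \<theta>) * w t U + of_real (sin \<theta>) * (coef z t * v t U))) =
          (LINT U|\<mu>. (\<Prod>r\<in>K. w r U))"
        by (simp cong: Bochner_Integration.integral_cong)
    next
      have nc: "norm (coef z t) = 1" for t using z by (simp add: coef_def)
      fix t U assume t: "t \<in> J" and U: "U \<in> space \<mu>"
      have U': "U \<in> unitary_mats d" using U space_haar[OF haar] by simp
      show "norm (w t U) \<le> 1" "norm (coef z t * v t U) \<le> 1"
        using t J(2) norm_unitary_entry_le[OF U'] ri ci opp
        by (auto simp: w_def v_def norm_mult nc)
    next
      fix U assume U: "U \<in> space \<mu>"
      have U': "U \<in> unitary_mats d" using U space_haar[OF haar] by simp
      show "norm (\<Prod>r\<in>K-J. w r U) \<le> 1"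
        by (rule norm_prod_le_1) (auto simp: w_def norm_unitary_entry_le[OF U'] ri ci)
    qed (use J(2) ri ci haar opp in \<open>auto simp: w_def v_def intro!: borel_measurable_prod
        borel_measurable_times measurable_cnj_unless_entry\<close>)
    moreover have "(LINT U|\<mu>. (\<Prod>r\<in>K-J. w r U) * (coef z t * v t U * (\<Prod>r\<in>J-{t}. w r U))) =
        coef z t * N t" if t: "t \<in> J" for t
    proof -
      have "(\<Prod>r\<in>K-J. w r U) * (coef z t * v t U * (\<Prod>r\<in>J-{t}. w r U)) =
        coef z t * (\<Prod>r\<in>K. cnj_unless (k r) (U $$ ((ri(t := opp t)) r, ci r)))" for U
      proof -
        have "(\<Prod>r\<in>K. cnj_unless (k r) (U $$ ((ri(t := opp t)) r, ci r))) =
          v t U * (\<Prod>r\<in>K-{t}. cnj_unless (k r) (U $$ ((ri(t := opp t)) r, ci r)))"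
          using t J(2) fin by (subst prod.remove[of _ t]) (auto simp: v_def)
        also have "(\<Prod>r\<in>K-{t}. cnj_unless (k r) (U $$ ((ri(t := opp t)) r, ci r))) = (\<Prod>r\<in>K-{t}. w r U)"
          by (intro prod.cong) (auto simp: w_def)
        also have "\<dots> = (\<Prod>r\<in>(K-{t})-(J-{t}). w r U) * (\<Prod>r\<in>J-{t}. w r U)"
          using J(2) fin by (intro prod.subset_diff) auto
        also have "(K-{t})-(J-{t}) = K - J" using t by auto
        finally show ?thesis by (simp add: mult_ac)
      qed
      then show ?thesis by (simp only: N_def haar_moment_def integral_mult_right_zero)
    qed
    ultimately show ?thesis by simp
  qed
  \<comment> \<open>Each coefficient has the form a \<open>z\<close> + b \<open>cnj z\<close>, so
    its value at 1 minus the imaginary unit times its value at the imaginary unit is 2a. Here a is 1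
    on plain slots in row \<open>p\<close>, -1 on conjugated slots in row \<open>q\<close>, and 0 on
    the other slots of \<open>J\<close>.\<close>
  have "0 = (\<Sum>t\<in>J. coef 1 t * N t) - \<i> * (\<Sum>t\<in>J. coef \<i> t * N t)"
    by (simp add: rot)
  also have "\<dots> = (\<Sum>t\<in>J. (coef 1 t - \<i> * coef \<i> t) * N t)"
    by (simp add: sum_distrib_left sum_subtractf algebra_simps)
  also have "\<dots> = (\<Sum>t\<in>J. 2 * ((if k t \<and> ri t = p then N t else 0) -
      (if \<not> k t \<and> ri t = q then N t else 0)))"
    using pq by (intro sum.cong) (auto simp: coef_def cnj_unless_def J_def)
  also have "\<dots> = 2 * ((\<Sum>t\<in>J. if k t \<and> ri t = p then N t else 0) -
      (\<Sum>t\<in>J. if \<not> k t \<and> ri t = q then N t else 0))"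
    by (simp only: sum_subtractf sum_distrib_left[symmetric])
  also have "(\<Sum>t\<in>J. if k t \<and> ri t = p then N t else 0) = (\<Sum>t | t \<in> K \<and> k t \<and> ri t = p. N t)"
    using fin by (intro sum.mono_neutral_cong_right) (auto simp: J_def)
  also have "(\<Sum>t\<in>J. if \<not> k t \<and> ri t = q then N t else 0) = (\<Sum>t | t \<in> K \<and> \<not> k t \<and> ri t = q. N t)"
    using fin pq by (intro sum.mono_neutral_cong_right) (auto simp: J_def)
  finally have "(\<Sum>t | t \<in> K \<and> k t \<and> ri t = p. N t) = (\<Sum>t | t \<in> K \<and> \<not> k t \<and> ri t = q. N t)"
    by simp
  then show ?thesis using pq by (simp add: N_def opp_def)
qed

section \<open>Solving the exchange relation\<close>

text \<open>The Young subgroup of the colouring \<open>clr\<close>, called P in the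
  overview.\<close>

definition colour_perms :: "nat \<Rightarrow> (nat \<Rightarrow> nat) \<Rightarrow> (nat \<Rightarrow> nat) set" where
  "colour_perms n clr = {\<pi>. \<pi> permutes {..<n} \<and> (\<forall>t<n. clr (\<pi> t) = clr t)}"

lemma finite_colour_perms: "finite (colour_perms n clr)"
  by (rule finite_subset[OF _ finite_permutations[of "{..<n}"]]) (auto simp: colour_perms_def)

text \<open>Index tuples are extensional functions, so that a condition such as
  \<open>a \<circ> \<pi> = c\<close> is plain equality of functions.\<close>

definition index_funs :: "nat \<Rightarrow> nat \<Rightarrow> (nat \<Rightarrow> nat) set" where
  "index_funs n d = {..<n} \<rightarrow>\<^sub>E {..<d}"

lemma index_funs_update: "a \<in> index_funs n d \<Longrightarrow> t < n \<Longrightarrow> q < d \<Longrightarrow> a(t := q) \<in> index_funs n d"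
  unfolding index_funs_def by (auto simp: PiE_def Pi_def extensional_def)

lemma index_funs_less: "a \<in> index_funs n d \<Longrightarrow> t < n \<Longrightarrow> a t < d"
  by (auto simp: index_funs_def)

lemma index_funs_eqI:
  assumes "a \<in> index_funs n d" "c \<in> index_funs n d" "\<And>t. t < n \<Longrightarrow> a t = c t"
  shows "a = c"
  using assms unfolding index_funs_def by (intro PiE_ext[of a "{..<n}" _ c]) auto

lemma index_funs_comp:
  assumes "a \<in> index_funs n d" "\<pi> permutes {..<n}"
  shows "a \<circ> \<pi> \<in> index_funs n d"
  using assms permutes_in_image[OF assms(2)] unfolding index_funs_def
  by (auto simp: PiE_def Pi_def extensional_def permutes_not_in)

text \<open>Induction on the set \<open>S\<close> of positions of \<open>c\<close> still to be moved
  to the target \<open>q\<close>. Moving position s uses the exchange relation with the value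
  \<open>q s\<close>, which the avoidance hypotheses make fresh. Once \<open>c\<close> is
  \<open>q\<close>, injectivity of \<open>q\<close> allows at most one matching \<pi>, and without a
  match the moment vanishes.\<close>

lemma exchange_expansion_step:
  fixes F :: "(nat \<Rightarrow> nat) \<Rightarrow> (nat \<Rightarrow> nat) \<Rightarrow> complex"
  assumes step: "\<And>a c s q. a \<in> index_funs n d \<Longrightarrow> c \<in> index_funs n d \<Longrightarrow> s < n \<Longrightarrow> q < d \<Longrightarrow>
      q \<notin> a ` {..<n} \<Longrightarrow> q \<notin> c ` {..<n} \<Longrightarrow>
      F a c = (\<Sum>t | t < n \<and> clr t = clr s \<and> a t = c s. F (a(t := q)) (c(s := q)))"
    and d: "2 * n < d"
    and q: "q \<in> index_funs n d" "inj_on q {..<n}"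
    and S: "S \<subseteq> {..<n}"
    and a: "a \<in> index_funs n d" "\<And>s. s \<in> S \<Longrightarrow> q s \<notin> a ` {..<n}"
    and c: "c \<in> index_funs n d" "\<And>s. s \<in> S \<Longrightarrow> c s \<notin> q ` {..<n}"
      "\<And>s. s < n \<Longrightarrow> s \<notin> S \<Longrightarrow> c s = q s"
  shows "F a c = (\<Sum>\<pi> | \<pi> \<in> colour_perms n clr \<and> a \<circ> \<pi> = c. F (q \<circ> Hilbert_Choice.inv \<pi>) q)"
proof -
  have "finite S" using S finite_subset by blast
  then show ?thesis using S a c
  proof (induction S arbitrary: a c rule: finite_induct)
    case (empty a c)
    have cq: "c = q" using empty.prems q by (intro index_funs_eqI) auto
    show ?case
    proof (cases "\<exists>\<pi>\<in>colour_perms n clr. a \<circ> \<pi> = q")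
      case True
      then obtain \<pi> where \<pi>: "\<pi> \<in> colour_perms n clr" "a \<circ> \<pi> = q" by blast
      have perm: "\<pi> permutes {..<n}" using \<pi>(1) by (simp add: colour_perms_def)
      have aq: "a = q \<circ> Hilbert_Choice.inv \<pi>"
        using \<pi>(2) permutes_inv_o(1)[OF perm] by (metis comp_assoc comp_id)
      have "\<pi>' = \<pi>" if "\<pi>' \<in> colour_perms n clr" "a \<circ> \<pi>' = q" for \<pi>'
      proof
        have p': "\<pi>' permutes {..<n}" using that(1) by (simp add: colour_perms_def)
        have inja: "inj_on a {..<n}"
          unfolding aq using permutes_inv[OF perm] q(2)
          by (metis comp_inj_on permutes_image permutes_inj_on)
        fix t show "\<pi>' t = \<pi> t"
        proof (cases "t < n")
          case True
          have "a (\<pi>' t) = a (\<pi> t)" using that(2) \<pi>(2) by (metis comp_apply)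
          then show ?thesis
            using inja True permutes_in_image[OF perm, of t] permutes_in_image[OF p', of t]
            by (auto dest: inj_onD)
        qed (use perm p' in \<open>auto simp: permutes_not_in\<close>)
      qed
      then have "{\<pi>. \<pi> \<in> colour_perms n clr \<and> a \<circ> \<pi> = q} = {\<pi>}" using \<pi> by blast
      moreover have "F a q = (\<Sum>\<pi>\<in>{\<pi>}. F (q \<circ> Hilbert_Choice.inv \<pi>) q)"
        using aq by (simp add: comp_def)
      ultimately show ?thesis by (simp only: cq)
    next
      case False
      \<comment> \<open>Otherwise each s has a position of its own colour at which \<open>a\<close>
        equals \<open>q s\<close>. Choosing such positions is injective because \<open>q\<close> is,
        so the choice is a permutation in P that matches \<open>a\<close> to
        \<open>q\<close>.\<close>
      have "\<exists>s<n. \<forall>t<n. clr t = clr s \<longrightarrow> a t \<noteq> q s"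
      proof (rule ccontr)
        assume "\<not> ?thesis"
        then have "\<forall>s. \<exists>t. s < n \<longrightarrow> t < n \<and> clr t = clr s \<and> a t = q s" by blast
        then obtain h where h: "\<And>s. s < n \<Longrightarrow> h s < n \<and> clr (h s) = clr s \<and> a (h s) = q s" by metis
        define \<pi> where "\<pi> s = (if s < n then h s else s)" for s
        have "inj_on \<pi> {..<n}"
          using h q(2) by (metis (no_types, lifting) \<pi>_def inj_on_def lessThan_iff)
        moreover have "\<pi> ` {..<n} \<subseteq> {..<n}" using h by (auto simp: \<pi>_def)
        ultimately have "\<pi> permutes {..<n}"
          using endo_inj_surj[of "{..<n}" \<pi>]
          by (intro bij_imp_permutes) (simp_all add: bij_betw_def, simp add: \<pi>_def)
        moreover have "a \<circ> \<pi> = q"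
          using h q(1) empty.prems
          by (intro index_funs_eqI[OF index_funs_comp[OF _ calculation] q(1)]) (auto simp: \<pi>_def)
        ultimately show False using False h by (auto simp: colour_perms_def \<pi>_def)
      qed
      then obtain s where s: "s < n" "\<And>t. t < n \<Longrightarrow> clr t = clr s \<Longrightarrow> a t \<noteq> q s" by blast
      have "card (h ` {..<n}) \<le> n" for h :: "nat \<Rightarrow> nat"
        using card_image_le[of "{..<n}" h] by simp
      then have "card (a ` {..<n} \<union> q ` {..<n}) \<le> n + n"
        by (intro order.trans[OF card_Un_le] add_mono)
      then have "\<not> {..<d} \<subseteq> a ` {..<n} \<union> q ` {..<n}"
        using d card_mono[of "a ` {..<n} \<union> q ` {..<n}" "{..<d}"] by auto
      \<comment> \<open>At most 2n values occur in \<open>a\<close> and \<open>q\<close>, so a fresh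
        one exists; the exchange relation at s then has an empty right-hand side.\<close>
      then obtain r where "r < d" "r \<notin> a ` {..<n}" "r \<notin> q ` {..<n}" by blast
      then have "F a q = (\<Sum>t | t < n \<and> clr t = clr s \<and> a t = q s. F (a(t := r)) (q(s := r)))"
        using empty.prems q(1) s(1) by (intro step) auto
      also have "{t. t < n \<and> clr t = clr s \<and> a t = q s} = {}" using s(2) by auto
      finally have "F a q = 0" by simp
      moreover have "{\<pi>. \<pi> \<in> colour_perms n clr \<and> a \<circ> \<pi> = q} = {}" using False by blast
      ultimately show ?thesis by (simp only: cq sum.empty)
    qed
  next
    case (insert s S a c)
    let ?P = "colour_perms n clr"
    let ?W = "\<lambda>\<pi>. F (q \<circ> Hilbert_Choice.inv \<pi>) q"
    have s: "s < n" "S \<subseteq> {..<n}" using insert.prems by auto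
    have qs: "q s < d" "q s \<notin> a ` {..<n}" "c s \<notin> q ` {..<n}"
      using insert.prems q(1) s(1) by (auto simp: index_funs_less)
    \<comment> \<open>Positions in \<open>insert s S\<close> avoid the range of \<open>q\<close>;
      the others carry a value of \<open>q\<close> that differs from \<open>q s\<close> by
      injectivity.\<close>
    have qc: "q s \<notin> c ` {..<n}"
    proof
      assume "q s \<in> c ` {..<n}"
      then obtain t where t: "t < n" "c t = q s" by auto
      show False
      proof (cases "t \<in> insert s S")
        case True
        then show ?thesis using insert.prems(5)[of t] t s(1) by auto
      next
        case False
        then have "q t = q s" using insert.prems(6)[of t] t by auto
        then have "t = s" using inj_onD[OF q(2), of t s] t s by simp
        then show ?thesis using False by simp
      qed
    qed
    \<comment> \<open>In the updated \<open>a\<close> the value \<open>q s\<close> occurs only at t,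
      so a match of the updated tuples forces t to be \<open>\<pi> s\<close>. Hence, when the
      induction hypothesis is summed over t, each \<pi> matching the original tuples is counted
      exactly once.\<close>
    have upd: "(a(t := q s) \<circ> \<pi> = c(s := q s) \<and> clr t = clr s \<and> a t = c s) \<longleftrightarrow> (a \<circ> \<pi> = c \<and> t = \<pi> s)"
      if \<pi>: "\<pi> \<in> ?P" and t: "t < n" for \<pi> t
    proof -
      have perm: "\<pi> permutes {..<n}" and cl: "clr (\<pi> s) = clr s"
        using \<pi> s(1) by (auto simp: colour_perms_def)
      have ps: "\<pi> s < n" using permutes_in_image[OF perm, of s] s(1) by simp
      show ?thesis
      proof
        assume A: "a(t := q s) \<circ> \<pi> = c(s := q s) \<and> clr t = clr s \<and> a t = c s"
        then have "(a(t := q s)) (\<pi> s) = q s" by (metis comp_apply fun_upd_same)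
        then have ts: "t = \<pi> s" using qs(2) ps by (metis fun_upd_other imageI lessThan_iff)
        have "a (\<pi> r) = c r" for r
        proof (cases "r = s")
          case True
          moreover have "a t = c s" using A by blast
          ultimately show ?thesis using ts by simp
        next
          case False
          then have "\<pi> r \<noteq> t" using ts permutes_inj[OF perm] by (metis injD)
          moreover have "(a(t := q s)) (\<pi> r) = (c(s := q s)) r" using A by (metis comp_apply)
          ultimately show ?thesis using False by simp
        qed
        with ts show "a \<circ> \<pi> = c \<and> t = \<pi> s" by (simp add: fun_eq_iff)
      next
        assume A: "a \<circ> \<pi> = c \<and> t = \<pi> s"
        then show "a(t := q s) \<circ> \<pi> = c(s := q s) \<and> clr t = clr s \<and> a t = c s"
          using cl permutes_inj[OF perm] by (auto simp: fun_eq_iff dest: injD)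
      qed
    qed
    let ?T = "{t. t < n \<and> clr t = clr s \<and> a t = c s}"
    have "F a c = (\<Sum>t\<in>?T. F (a(t := q s)) (c(s := q s)))"
      using insert.prems s qs qc by (intro step) auto
    also have "\<dots> = (\<Sum>t\<in>?T. \<Sum>\<pi> | \<pi> \<in> ?P \<and> a(t := q s) \<circ> \<pi> = c(s := q s). ?W \<pi>)"
    proof (rule sum.cong[OF refl])
      fix t assume t: "t \<in> ?T"
      have ne: "q s' \<noteq> q s" if "s' \<in> S" for s'
        using that insert.hyps s q(2) by (auto simp: inj_on_def)
      have "q s' \<notin> (a(t := q s)) ` {..<n}" if "s' \<in> S" for s'
        using insert.prems(3)[of s'] ne[OF that] that by auto
      moreover have "(c(s := q s)) s' \<notin> q ` {..<n}" if "s' \<in> S" for s'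
        using insert.prems(5)[of s'] insert.hyps that by auto
      moreover have "(c(s := q s)) s' = q s'" if "s' < n" "s' \<notin> S" for s'
        using insert.prems(6)[of s'] that by simp
      ultimately show "F (a(t := q s)) (c(s := q s)) =
          (\<Sum>\<pi> | \<pi> \<in> ?P \<and> a(t := q s) \<circ> \<pi> = c(s := q s). ?W \<pi>)"
        using insert.prems t s qs(1)
        by (intro insert.IH index_funs_update) (auto simp del: fun_upd_apply)
    qed
    also have "\<dots> = (\<Sum>t\<in>?T. \<Sum>\<pi>\<in>?P. if a(t := q s) \<circ> \<pi> = c(s := q s) then ?W \<pi> else 0)"
      by (rule sum.cong[OF refl]) (rule sum.inter_filter[OF finite_colour_perms])
    also have "\<dots> = (\<Sum>\<pi>\<in>?P. \<Sum>t\<in>?T. if a(t := q s) \<circ> \<pi> = c(s := q s) then ?W \<pi> else 0)"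
      by (rule sum.swap)
    also have "\<dots> = (\<Sum>\<pi>\<in>?P. \<Sum>t<n. if a \<circ> \<pi> = c \<and> t = \<pi> s then ?W \<pi> else 0)"
    proof (rule sum.cong[OF refl])
      fix \<pi> assume \<pi>: "\<pi> \<in> ?P"
      have "(\<Sum>t\<in>?T. if a(t := q s) \<circ> \<pi> = c(s := q s) then ?W \<pi> else 0) =
        (\<Sum>t<n. if a(t := q s) \<circ> \<pi> = c(s := q s) \<and> clr t = clr s \<and> a t = c s then ?W \<pi> else 0)"
        by (rule sum.mono_neutral_cong_left) auto
      also have "\<dots> = (\<Sum>t<n. if a \<circ> \<pi> = c \<and> t = \<pi> s then ?W \<pi> else 0)"
        by (intro sum.cong if_cong upd[OF \<pi>]) auto
      finally show "(\<Sum>t\<in>?T. if a(t := q s) \<circ> \<pi> = c(s := q s) then ?W \<pi> else 0) =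
        (\<Sum>t<n. if a \<circ> \<pi> = c \<and> t = \<pi> s then ?W \<pi> else 0)" .
    qed
    also have "\<dots> = (\<Sum>\<pi>\<in>?P. if a \<circ> \<pi> = c then ?W \<pi> else 0)"
    proof (rule sum.cong[OF refl])
      fix \<pi> assume "\<pi> \<in> ?P"
      then have "\<pi> s < n" using s(1) permutes_in_image[of \<pi> "{..<n}" s] by (auto simp: colour_perms_def)
      then show "(\<Sum>t<n. if a \<circ> \<pi> = c \<and> t = \<pi> s then ?W \<pi> else 0) = (if a \<circ> \<pi> = c then ?W \<pi> else 0)"
        by (cases "a \<circ> \<pi> = c") auto
    qed
    also have "\<dots> = (\<Sum>\<pi> | \<pi> \<in> ?P \<and> a \<circ> \<pi> = c. ?W \<pi>)"
      by (rule sum.inter_filter[OF finite_colour_perms, symmetric])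
    finally show ?case .
  qed
qed

text \<open>The weights of \<open>exchange_expansion_step\<close> belong to a target
  \<open>q\<close> that has to avoid \<open>a\<close> and \<open>c\<close>. They are made uniform by
  comparison with one fixed tuple \<open>q0\<close>: expanding the weight of \<pi> for
  \<open>q0\<close> along a disjoint \<open>q\<close> leaves a single term, the weight of \<pi> for
  \<open>q\<close>.\<close>

lemma exchange_expansion:
  fixes F :: "(nat \<Rightarrow> nat) \<Rightarrow> (nat \<Rightarrow> nat) \<Rightarrow> complex"
  assumes step: "\<And>a c s q. a \<in> index_funs n d \<Longrightarrow> c \<in> index_funs n d \<Longrightarrow> s < n \<Longrightarrow> q < d \<Longrightarrow>
      q \<notin> a ` {..<n} \<Longrightarrow> q \<notin> c ` {..<n} \<Longrightarrow>
      F a c = (\<Sum>t | t < n \<and> clr t = clr s \<and> a t = c s. F (a(t := q)) (c(s := q)))"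
    and d: "4 * n < d"
  obtains f where "\<And>a c. a \<in> index_funs n d \<Longrightarrow> c \<in> index_funs n d \<Longrightarrow>
    F a c = (\<Sum>\<pi> | \<pi> \<in> colour_perms n clr \<and> a \<circ> \<pi> = c. f \<pi>)"
proof -
  define q0 :: "nat \<Rightarrow> nat" where "q0 = restrict id {..<n}"
  have q0: "q0 \<in> index_funs n d" "inj_on q0 {..<n}"
    using d by (auto simp: q0_def index_funs_def inj_on_def)
  have expand: "F a c = (\<Sum>\<pi> | \<pi> \<in> colour_perms n clr \<and> a \<circ> \<pi> = c. F (q \<circ> Hilbert_Choice.inv \<pi>) q)"
    if "a \<in> index_funs n d" "c \<in> index_funs n d" "q \<in> index_funs n d" "inj_on q {..<n}"
      "q ` {..<n} \<inter> a ` {..<n} = {}" "q ` {..<n} \<inter> c ` {..<n} = {}" for a c q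
    using that d by (intro exchange_expansion_step[where S = "{..<n}"] step) auto
  have indep: "F (q0 \<circ> Hilbert_Choice.inv \<pi>) q0 = F (q \<circ> Hilbert_Choice.inv \<pi>) q"
    if "q \<in> index_funs n d" "inj_on q {..<n}" "q ` {..<n} \<inter> q0 ` {..<n} = {}" "\<pi> \<in> colour_perms n clr"
    for q \<pi>
  proof -
    have perm: "\<pi> permutes {..<n}" using that(4) by (simp add: colour_perms_def)
    have "(q0 \<circ> Hilbert_Choice.inv \<pi>) ` {..<n} = q0 ` {..<n}"
      using permutes_image[OF permutes_inv[OF perm]] by (simp flip: image_image add: image_comp[symmetric])
    then have "F (q0 \<circ> Hilbert_Choice.inv \<pi>) q0 =
      (\<Sum>\<pi>' | \<pi>' \<in> colour_perms n clr \<and> q0 \<circ> Hilbert_Choice.inv \<pi> \<circ> \<pi>' = q0. F (q \<circ> Hilbert_Choice.inv \<pi>') q)"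
      using that q0 by (intro expand index_funs_comp permutes_inv[OF perm]) auto
    also have "{\<pi>'. \<pi>' \<in> colour_perms n clr \<and> q0 \<circ> Hilbert_Choice.inv \<pi> \<circ> \<pi>' = q0} = {\<pi>}"
    proof (intro equalityI subsetI)
      fix \<pi>' assume "\<pi>' \<in> {\<pi>'. \<pi>' \<in> colour_perms n clr \<and> q0 \<circ> Hilbert_Choice.inv \<pi> \<circ> \<pi>' = q0}"
      then have p': "\<pi>' permutes {..<n}" and eq: "q0 (Hilbert_Choice.inv \<pi> (\<pi>' t)) = q0 t" for t
        by (auto simp: colour_perms_def fun_eq_iff)
      have "\<pi>' t = \<pi> t" for t
      proof (cases "t < n")
        case True
        then have "Hilbert_Choice.inv \<pi> (\<pi>' t) < n"
          using permutes_in_image[OF p', of t] permutes_in_image[OF permutes_inv[OF perm], of "\<pi>' t"] by simp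
        with True have "Hilbert_Choice.inv \<pi> (\<pi>' t) = t" using inj_onD[OF q0(2) eq] by simp
        then show ?thesis using permutes_inverses(1)[OF perm] by metis
      qed (use perm p' in \<open>auto simp: permutes_not_in\<close>)
      then show "\<pi>' \<in> {\<pi>}" by auto
    qed (use that(4) permutes_inv_o(2)[OF perm] in \<open>simp add: comp_assoc\<close>)
    finally show ?thesis by (simp add: comp_def)
  qed
  show ?thesis
  proof (rule that)
    fix a c assume ac: "a \<in> index_funs n d" "c \<in> index_funs n d"
    \<comment> \<open>\<open>q\<close> needs n distinct values outside these at most 3n values; this
      explains the bound 4n.\<close>
    let ?X = "a ` {..<n} \<union> c ` {..<n} \<union> q0 ` {..<n}"
    have le: "card (h ` {..<n}) \<le> n" for h :: "nat \<Rightarrow> nat"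
      using card_image_le[of "{..<n}" h] by simp
    have "card ?X \<le> n + n + n"
      by (intro order.trans[OF card_Un_le] add_mono le)
    then have "n \<le> card ({..<d} - ?X)"
      using d diff_card_le_card_Diff[of ?X "{..<d}"] by simp
    then obtain h where h: "h ` {..<n} \<subseteq> {..<d} - ?X" "inj_on h {..<n}"
      using card_le_inj[of "{..<n}" "{..<d} - ?X"] by auto
    define q where "q = restrict h {..<n}"
    have q: "q \<in> index_funs n d" "inj_on q {..<n}" "q ` {..<n} \<inter> ?X = {}"
      using h by (auto simp: q_def index_funs_def inj_on_def)
    have "F a c = (\<Sum>\<pi> | \<pi> \<in> colour_perms n clr \<and> a \<circ> \<pi> = c. F (q \<circ> Hilbert_Choice.inv \<pi>) q)"
      using q ac by (intro expand) auto
    also have "\<dots> = (\<Sum>\<pi> | \<pi> \<in> colour_perms n clr \<and> a \<circ> \<pi> = c. F (q0 \<circ> Hilbert_Choice.inv \<pi>) q0)"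
      using q by (intro sum.cong refl indep[symmetric]) auto
    finally show "F a c = (\<Sum>\<pi> | \<pi> \<in> colour_perms n clr \<and> a \<circ> \<pi> = c. F (q0 \<circ> Hilbert_Choice.inv \<pi>) q0)" .
  qed
qed

section \<open>Joint moments of independent Haar unitaries\<close>

definition colour_word ::
    "nat \<Rightarrow> (nat \<Rightarrow> nat) \<Rightarrow> (nat \<Rightarrow> complex mat) \<Rightarrow> (nat \<Rightarrow> nat) \<Rightarrow> (nat \<Rightarrow> nat) \<Rightarrow> complex" where
  "colour_word n clr U a b = (\<Prod>t<n. U (clr t) $$ (a t, b t))"

text \<open>The column tuples \<open>b\<close> and \<open>e\<close> come first: fixing them leaves
  the function of the row tuples \<open>a\<close> and \<open>c\<close> that obeys the exchange
  relation.\<close>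

definition joint_moment ::
    "nat \<Rightarrow> nat \<Rightarrow> (nat \<Rightarrow> nat) \<Rightarrow> complex mat measure \<Rightarrow>
     (nat \<Rightarrow> nat) \<Rightarrow> (nat \<Rightarrow> nat) \<Rightarrow> (nat \<Rightarrow> nat) \<Rightarrow> (nat \<Rightarrow> nat) \<Rightarrow> complex" where
  "joint_moment n g clr \<mu> b e a c =
     (LINT U|PiM {..<g} (\<lambda>_. \<mu>). colour_word n clr U a b * cnj (colour_word n clr U c e))"

text \<open>Slot \<open>(t, True)\<close> is the plain entry at position t and slot
  \<open>(t, False)\<close> the conjugated one, so that \<open>haar_moment\<close> applies with
  \<open>snd\<close> as its flag.\<close>

definition pair_index :: "(nat \<Rightarrow> nat) \<Rightarrow> (nat \<Rightarrow> nat) \<Rightarrow> nat \<times> bool \<Rightarrow> nat" where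
  "pair_index a c \<tau> = (if snd \<tau> then a (fst \<tau>) else c (fst \<tau>))"

abbreviation colour_slots :: "nat \<Rightarrow> (nat \<Rightarrow> nat) \<Rightarrow> nat \<Rightarrow> (nat \<times> bool) set" where
  "colour_slots n clr j \<equiv> {t. t < n \<and> clr t = j} \<times> UNIV"

lemma colour_word_factor:
  assumes clr: "\<forall>t<n. clr t < g"
  shows "colour_word n clr U a b * cnj (colour_word n clr U c e) =
    (\<Prod>j<g. \<Prod>\<tau>\<in>colour_slots n clr j. cnj_unless (snd \<tau>) (U j $$ (pair_index a c \<tau>, pair_index b e \<tau>)))"
proof -
  have "colour_word n clr U a b * cnj (colour_word n clr U c e) =
      (\<Prod>t<n. U (clr t) $$ (a t, b t) * cnj (U (clr t) $$ (c t, e t)))"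
    by (simp add: colour_word_def prod.distrib cnj_prod)
  also have "\<dots> = (\<Prod>j<g. \<Prod>t | t \<in> {..<n} \<and> clr t = j.
      U (clr t) $$ (a t, b t) * cnj (U (clr t) $$ (c t, e t)))"
    using clr by (intro prod.group[symmetric]) auto
  also have "\<dots> = (\<Prod>j<g. \<Prod>\<tau>\<in>colour_slots n clr j.
      cnj_unless (snd \<tau>) (U j $$ (pair_index a c \<tau>, pair_index b e \<tau>)))"
  proof (rule prod.cong[OF refl])
    fix j
    have "(\<Prod>\<tau>\<in>colour_slots n clr j. cnj_unless (snd \<tau>) (U j $$ (pair_index a c \<tau>, pair_index b e \<tau>))) =
      (\<Prod>t | t < n \<and> clr t = j. \<Prod>k\<in>UNIV. cnj_unless k (U j $$ (pair_index a c (t, k), pair_index b e (t, k))))"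
      by (subst prod.cartesian_product) (auto intro!: prod.cong)
    also have "\<dots> = (\<Prod>t | t \<in> {..<n} \<and> clr t = j. U (clr t) $$ (a t, b t) * cnj (U (clr t) $$ (c t, e t)))"
      by (intro prod.cong) (auto simp: UNIV_bool pair_index_def cnj_unless_def)
    finally show "(\<Prod>t | t \<in> {..<n} \<and> clr t = j. U (clr t) $$ (a t, b t) * cnj (U (clr t) $$ (c t, e t))) =
      (\<Prod>\<tau>\<in>colour_slots n clr j. cnj_unless (snd \<tau>) (U j $$ (pair_index a c \<tau>, pair_index b e \<tau>)))" ..
  qed
  finally show ?thesis .
qed

lemma integrable_haar_product:
  assumes haar: "is_haar_unitary d \<mu>" and fin: "finite K"
    and ri: "\<And>t. t \<in> K \<Longrightarrow> ri t < d" and ci: "\<And>t. t \<in> K \<Longrightarrow> ci t < d"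
  shows "integrable \<mu> (\<lambda>U. \<Prod>t\<in>K. cnj_unless (k t) (U $$ (ri t, ci t)))"
proof -
  interpret prob_space \<mu> using haar by (simp add: is_haar_unitary_def)
  show ?thesis
  proof (rule integrable_bounded_by_1)
    show "(\<lambda>U. \<Prod>t\<in>K. cnj_unless (k t) (U $$ (ri t, ci t))) \<in> borel_measurable \<mu>"
      by (intro borel_measurable_prod measurable_cnj_unless_entry[OF haar] ri ci)
    fix U assume "U \<in> space \<mu>"
    then have "U \<in> unitary_mats d" using space_haar[OF haar] by simp
    then show "norm (\<Prod>t\<in>K. cnj_unless (k t) (U $$ (ri t, ci t))) \<le> 1"
      by (intro norm_prod_le_1) (simp add: norm_unitary_entry_le ri ci)
  qed
qed

lemma pair_index_less:
  assumes "a \<in> index_funs n d" "c \<in> index_funs n d" "\<tau> \<in> colour_slots n clr j"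
  shows "pair_index a c \<tau> < d"
  using assms by (auto simp: pair_index_def index_funs_less)

text \<open>After grouping by colour each factor depends on one matrix only, so independence turns
  the integral of the product into a product of integrals.\<close>

lemma joint_moment_factor:
  assumes clr: "\<forall>t<n. clr t < g" and haar: "is_haar_unitary d \<mu>"
    and ind: "a \<in> index_funs n d" "b \<in> index_funs n d" "c \<in> index_funs n d" "e \<in> index_funs n d"
  shows "joint_moment n g clr \<mu> b e a c =
    (\<Prod>j<g. haar_moment \<mu> (colour_slots n clr j) snd (pair_index b e) (pair_index a c))"
proof -
  interpret prob_space \<mu> using haar by (simp add: is_haar_unitary_def)
  interpret product_prob_space "\<lambda>_::nat. \<mu>" UNIV by unfold_locales
  show ?thesis
    unfolding joint_moment_def haar_moment_def colour_word_factor[OF clr]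
    by (rule product_integral_prod)
      (auto intro!: integrable_haar_product[OF haar] pair_index_less[OF ind(1,3)] pair_index_less[OF ind(2,4)])
qed

text \<open>Only the factor of colour \<open>clr s\<close> is affected. There,
  \<open>haar_moment_exchange\<close> is applied to the rows \<open>c s\<close> and
  \<open>q\<close>, starting from the tuple \<open>c\<close> whose position s has already been moved
  to \<open>q\<close>.\<close>

lemma joint_moment_exchange:
  assumes clr: "\<forall>t<n. clr t < g" and haar: "is_haar_unitary d \<mu>"
    and ind: "b \<in> index_funs n d" "e \<in> index_funs n d" "a \<in> index_funs n d" "c \<in> index_funs n d"
    and s: "s < n" and q: "q < d" "q \<notin> a ` {..<n}" "q \<notin> c ` {..<n}"
  shows "joint_moment n g clr \<mu> b e a c =
    (\<Sum>t | t < n \<and> clr t = clr s \<and> a t = c s. joint_moment n g clr \<mu> b e (a(t := q)) (c(s := q)))"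
proof -
  define M where "M j a c = haar_moment \<mu> (colour_slots n clr j) snd (pair_index b e) (pair_index a c)" for j a c
  let ?j = "clr s" and ?p = "c s"
  let ?T = "{t. t < n \<and> clr t = ?j \<and> a t = ?p}"
  have factor: "joint_moment n g clr \<mu> b e a' c' = M ?j a' c' * (\<Prod>j\<in>{..<g} - {?j}. M j a' c')"
    if "a' \<in> index_funs n d" "c' \<in> index_funs n d" for a' c'
    unfolding joint_moment_factor[OF clr haar that(1) ind(1) that(2) ind(2)] M_def
    using clr s by (subst prod.remove[of _ ?j]) auto
  have p: "?p < d" "?p \<noteq> q" using ind s q by (auto simp: index_funs_less)
  have cs: "c(s := q) \<in> index_funs n d" using ind s q by (intro index_funs_update)
  let ?K = "colour_slots n clr ?j" and ?ri = "pair_index a (c(s := q))"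
  have "(\<Sum>\<tau> | \<tau> \<in> ?K \<and> snd \<tau> \<and> ?ri \<tau> = ?p. haar_moment \<mu> ?K snd (pair_index b e) (?ri(\<tau> := q))) =
        (\<Sum>\<tau> | \<tau> \<in> ?K \<and> \<not> snd \<tau> \<and> ?ri \<tau> = q. haar_moment \<mu> ?K snd (pair_index b e) (?ri(\<tau> := ?p)))"
    by (rule haar_moment_exchange[OF haar])
      (use p q in \<open>auto intro: pair_index_less[OF ind(3) cs] pair_index_less[OF ind(1,2)] simp del: fun_upd_apply\<close>)
  \<comment> \<open>Freshness of \<open>q\<close> leaves one conjugated slot in row
    \<open>q\<close>, namely that of s; moving it back to row \<open>c s\<close> restores
    \<open>c\<close>.\<close>
  also have "{\<tau>. \<tau> \<in> ?K \<and> \<not> snd \<tau> \<and> ?ri \<tau> = q} = {(s, False)}"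
    using s q by (auto simp: pair_index_def split: if_splits)
  also have "?ri((s, False) := ?p) = pair_index a c"
    by (auto simp: pair_index_def fun_eq_iff)
  then have "(\<Sum>\<tau>\<in>{(s, False)}. haar_moment \<mu> ?K snd (pair_index b e) (?ri(\<tau> := ?p))) = M ?j a c"
    by (simp only: M_def sum.insert finite.emptyI sum.empty empty_iff not_False_eq_True add_0_right)
  also have "{\<tau>. \<tau> \<in> ?K \<and> snd \<tau> \<and> ?ri \<tau> = ?p} = (\<lambda>t. (t, True)) ` ?T"
    by (auto simp: pair_index_def)
  also have "(\<Sum>\<tau>\<in>(\<lambda>t. (t, True)) ` ?T. haar_moment \<mu> ?K snd (pair_index b e) (?ri(\<tau> := q))) =
      (\<Sum>t\<in>?T. M ?j (a(t := q)) (c(s := q)))"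
  proof (rule sum.reindex_cong[of "\<lambda>t. (t, True)"])
    fix t
    have "?ri((t, True) := q) = pair_index (a(t := q)) (c(s := q))"
      by (auto simp: pair_index_def fun_eq_iff)
    then show "haar_moment \<mu> ?K snd (pair_index b e) (?ri((t, True) := q)) = M ?j (a(t := q)) (c(s := q))"
      by (simp only: M_def)
  qed (auto simp: inj_on_def)
  finally have main: "M ?j a c = (\<Sum>t\<in>?T. M ?j (a(t := q)) (c(s := q)))" ..
  have "joint_moment n g clr \<mu> b e a c = (\<Sum>t\<in>?T. M ?j (a(t := q)) (c(s := q)) * (\<Prod>j\<in>{..<g} - {?j}. M j a c))"
    unfolding factor[OF ind(3,4)] main by (rule sum_distrib_right)
  also have "\<dots> = (\<Sum>t\<in>?T. joint_moment n g clr \<mu> b e (a(t := q)) (c(s := q)))"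
  proof (rule sum.cong[OF refl])
    fix t assume t: "t \<in> ?T"
    then have at: "a(t := q) \<in> index_funs n d" using ind q by (intro index_funs_update) auto
    \<comment> \<open>Positions s and t both have colour \<open>clr s\<close>, so the factors of
      other colours do not see the update.\<close>
    have "M j a c = M j (a(t := q)) (c(s := q))" if "j \<noteq> ?j" for j
      unfolding M_def haar_moment_def
      using t that by (intro Bochner_Integration.integral_cong prod.cong refl) (auto simp: pair_index_def)
    then show "M ?j (a(t := q)) (c(s := q)) * (\<Prod>j\<in>{..<g} - {?j}. M j a c) =
        joint_moment n g clr \<mu> b e (a(t := q)) (c(s := q))"
      unfolding factor[OF at cs] by (intro arg_cong2[of _ _ _ _ "(*)"] prod.cong refl) auto
  qed
  finally show ?thesis .
qed

section \<open>Contracting the row indices by orthonormality of columns\<close>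

lemma integrable_colour_words:
  assumes clr: "\<forall>t<n. clr t < g" and haar: "is_haar_unitary d \<mu>"
    and ind: "a \<in> index_funs n d" "b \<in> index_funs n d" "c \<in> index_funs n d" "e \<in> index_funs n d"
  shows "integrable (PiM {..<g} (\<lambda>_. \<mu>)) (\<lambda>U. colour_word n clr U a b * cnj (colour_word n clr U c e))"
proof -
  interpret prob_space \<mu> using haar by (simp add: is_haar_unitary_def)
  interpret product_prob_space "\<lambda>_::nat. \<mu>" UNIV by unfold_locales
  show ?thesis
    unfolding colour_word_factor[OF clr]
    by (rule product_integrable_prod)
      (auto intro!: integrable_haar_product[OF haar] pair_index_less[OF ind(1,3)] pair_index_less[OF ind(2,4)])
qed

lemma finite_index_funs: "finite (index_funs n d)"
  by (simp add: index_funs_def finite_PiE)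

lemma card_index_funs: "card (index_funs n d) = d ^ n"
  by (simp add: index_funs_def card_PiE)

text \<open>Since \<rho> preserves colours, the factors of the second word can be permuted so that
  both words use the same matrix and the same row at every position. The sum over \<open>a\<close>
  then splits into one sum per position, each an inner product of two columns.\<close>

lemma colour_word_contraction:
  assumes clr: "\<forall>t<n. clr t < g" and U: "\<And>j. j < g \<Longrightarrow> U j \<in> unitary_mats d"
    and ind: "b \<in> index_funs n d" "e \<in> index_funs n d" and \<rho>: "\<rho> \<in> colour_perms n clr"
  shows "(\<Sum>a\<in>index_funs n d. colour_word n clr U a b * cnj (colour_word n clr U (a \<circ> \<rho>) e)) =
    (if b \<circ> \<rho> = e then 1 else 0)"
proof -
  have perm: "\<rho> permutes {..<n}" and cl: "\<And>t. t < n \<Longrightarrow> clr (\<rho> t) = clr t"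
    using \<rho> by (auto simp: colour_perms_def)
  let ?e = "\<lambda>t. e (Hilbert_Choice.inv \<rho> t)"
  have inv_less: "Hilbert_Choice.inv \<rho> t < n" if "t < n" for t
    using permutes_in_image[OF permutes_inv[OF perm], of t] that by simp
  have "colour_word n clr U (a \<circ> \<rho>) e = (\<Prod>t<n. U (clr t) $$ (a t, ?e t))" for a
    unfolding colour_word_def using cl
    by (subst (2) prod.permute[OF perm]) (simp add: permutes_inverses(2)[OF perm])
  then have "(\<Sum>a\<in>index_funs n d. colour_word n clr U a b * cnj (colour_word n clr U (a \<circ> \<rho>) e)) =
      (\<Sum>a\<in>index_funs n d. \<Prod>t<n. U (clr t) $$ (a t, b t) * cnj (U (clr t) $$ (a t, ?e t)))"
    by (simp only: colour_word_def prod.distrib cnj_prod)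
  also have "\<dots> = (\<Prod>t<n. \<Sum>i<d. U (clr t) $$ (i, b t) * cnj (U (clr t) $$ (i, ?e t)))"
    unfolding index_funs_def by (rule prod_sum_PiE[symmetric]) auto
  also have "\<dots> = (\<Prod>t<n. if b t = ?e t then 1 else 0)"
    using ind by (intro prod.cong refl unitary_mats_columns U) (auto simp: clr intro: index_funs_less inv_less)
  also have "\<dots> = (if \<forall>t<n. b t = ?e t then 1 else 0)"
    by (auto intro!: prod.neutral prod_zero)
  also have "(\<forall>t<n. b t = ?e t) \<longleftrightarrow> b \<circ> \<rho> = e"
  proof
    assume A: "\<forall>t<n. b t = ?e t"
    show "b \<circ> \<rho> = e"
    proof (rule index_funs_eqI[OF index_funs_comp[OF ind(1) perm] ind(2)])
      fix t assume "t < n"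
      then have "\<rho> t < n" using permutes_in_image[OF perm, of t] by simp
      with A show "(b \<circ> \<rho>) t = e t" by (simp add: permutes_inverses(2)[OF perm])
    qed
  next
    assume "b \<circ> \<rho> = e"
    then show "\<forall>t<n. b t = ?e t" by (auto simp: permutes_inverses(1)[OF perm])
  qed
  finally show ?thesis .
qed

text \<open>The contraction is constant on tuples of unitaries, so integrating it against a
  probability measure returns that constant.\<close>

lemma joint_moment_contraction:
  assumes clr: "\<forall>t<n. clr t < g" and haar: "is_haar_unitary d \<mu>"
    and ind: "b \<in> index_funs n d" "e \<in> index_funs n d" and \<rho>: "\<rho> \<in> colour_perms n clr"
  shows "(\<Sum>a\<in>index_funs n d. joint_moment n g clr \<mu> b e a (a \<circ> \<rho>)) = (if b \<circ> \<rho> = e then 1 else 0)"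
proof -
  interpret prob_space \<mu> using haar by (simp add: is_haar_unitary_def)
  interpret joint: prob_space "PiM {..<g} (\<lambda>_. \<mu>)"
    by (rule prob_space_PiM) (rule prob_space_axioms)
  have perm: "\<rho> permutes {..<n}" using \<rho> by (auto simp: colour_perms_def)
  have "(\<Sum>a\<in>index_funs n d. joint_moment n g clr \<mu> b e a (a \<circ> \<rho>)) =
    (LINT U|PiM {..<g} (\<lambda>_. \<mu>). (\<Sum>a\<in>index_funs n d.
       colour_word n clr U a b * cnj (colour_word n clr U (a \<circ> \<rho>) e)))"
    unfolding joint_moment_def
    using ind by (intro Bochner_Integration.integral_sum[symmetric]
        integrable_colour_words[OF clr haar] index_funs_comp perm) auto
  also have "\<dots> = (LINT U|PiM {..<g} (\<lambda>_. \<mu>). (if b \<circ> \<rho> = e then 1 else 0))"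
  proof (rule Bochner_Integration.integral_cong[OF refl])
    fix U assume "U \<in> space (PiM {..<g} (\<lambda>_. \<mu>))"
    then have "U j \<in> unitary_mats d" if "j < g" for j
      using that space_haar[OF haar] by (auto simp: space_PiM)
    then show "(\<Sum>a\<in>index_funs n d. colour_word n clr U a b * cnj (colour_word n clr U (a \<circ> \<rho>) e)) =
      (if b \<circ> \<rho> = e then 1 else 0)"
      using ind \<rho> by (intro colour_word_contraction[where g = g] clr)
  qed
  also have "\<dots> = (if b \<circ> \<rho> = e then 1 else 0)"
    using joint.prob_space by simp
  finally show ?thesis .
qed

section \<open>Asymptotics of the weights\<close>

lemma card_coincidences_refl: "card {a \<in> index_funs n d. a \<circ> x = a \<circ> x} = d ^ n"
  by (simp add: card_index_funs)

text \<open>If x and y differ at t, the value of \<open>a\<close> at \<open>x t\<close> must equal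
  its value at the other point \<open>y t\<close>. So \<open>a\<close> is determined by its values
  off \<open>x t\<close>, which costs a factor d.\<close>

lemma card_coincidences_le:
  assumes x: "x permutes {..<n}" and y: "y permutes {..<n}" and xy: "x \<noteq> y"
  shows "card {a \<in> index_funs n d. a \<circ> x = a \<circ> y} * d \<le> d ^ n"
proof -
  obtain t where t: "x t \<noteq> y t" using xy by (auto simp: fun_eq_iff)
  then have tn: "t < n" using x y t by (metis lessThan_iff permutes_not_in)
  have xt: "x t < n" "y t < n"
    using tn permutes_in_image[OF x, of t] permutes_in_image[OF y, of t] by simp_all
  let ?S = "{a \<in> index_funs n d. a \<circ> x = a \<circ> y}" and ?A = "{..<n} - {x t}"
  have "card ?S \<le> card (?A \<rightarrow>\<^sub>E {..<d})"
  proof (rule card_inj_on_le)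
    show "(\<lambda>a. restrict a ?A) ` ?S \<subseteq> ?A \<rightarrow>\<^sub>E {..<d}"
    proof (rule image_subsetI)
      fix a assume "a \<in> ?S"
      then have "a \<in> index_funs n d" by blast
      then show "restrict a ?A \<in> ?A \<rightarrow>\<^sub>E {..<d}"
        unfolding restrict_PiE_iff by (simp add: index_funs_less)
    qed
    show "inj_on (\<lambda>a. restrict a ?A) ?S"
    proof
      fix a c assume a: "a \<in> ?S" and c: "c \<in> ?S" and eq: "restrict a ?A = restrict c ?A"
      have off: "a r = c r" if "r < n" "r \<noteq> x t" for r
        using fun_cong[OF eq, of r] that by simp
      have "a (x t) = a (y t)" "c (x t) = c (y t)"
        using a c by (auto dest: fun_cong[of _ _ t])
      then have "a (x t) = c (x t)" using off[of "y t"] xt t by simp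
      then have "a r = c r" if "r < n" for r using off that by (cases "r = x t") auto
      then show "a = c" using a c by (intro index_funs_eqI[of a n d c]) auto
    qed
  qed (simp add: finite_PiE)
  also have "\<dots> = d ^ (n - 1)"
    using xt by (simp add: card_PiE)
  finally have "card ?S * d \<le> d ^ (n - 1) * d" by (rule mult_right_mono) simp
  also have "\<dots> = d ^ n" using tn by (simp flip: power_Suc2)
  finally show ?thesis .
qed

text \<open>Row \<rho> of the system expresses \<open>h - B\<close> through the off-diagonal part of
  \<open>G\<close>, of size at most \<open>card P * \<epsilon> * m\<close> with m the largest
  modulus in \<open>h\<close>. This first gives m \<le> 1 + m/2, hence m \<le> 2, and then the
  claim.\<close>

lemma near_identity_system_bound:
  fixes G B h :: "'a \<Rightarrow> 'a \<Rightarrow> complex"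
  assumes fin: "finite P"
    and sys: "\<And>\<rho> \<pi>. \<rho> \<in> P \<Longrightarrow> \<pi> \<in> P \<Longrightarrow> (\<Sum>\<pi>'\<in>P. G \<rho> \<pi>' * h \<pi>' \<pi>) = B \<rho> \<pi>"
    and G1: "\<And>\<rho>. \<rho> \<in> P \<Longrightarrow> G \<rho> \<rho> = 1"
    and G2: "\<And>\<rho> \<pi>. \<rho> \<in> P \<Longrightarrow> \<pi> \<in> P \<Longrightarrow> \<rho> \<noteq> \<pi> \<Longrightarrow> norm (G \<rho> \<pi>) \<le> \<epsilon>"
    and B1: "\<And>\<rho> \<pi>. \<rho> \<in> P \<Longrightarrow> \<pi> \<in> P \<Longrightarrow> norm (B \<rho> \<pi>) \<le> 1"
    and \<epsilon>: "0 \<le> \<epsilon>" "2 * real (card P) * \<epsilon> \<le> 1"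
    and "\<rho> \<in> P" "\<pi> \<in> P"
  shows "norm (h \<rho> \<pi> - B \<rho> \<pi>) \<le> 2 * real (card P) * \<epsilon>"
proof -
  define m where "m = Max ((\<lambda>(\<rho>, \<pi>). norm (h \<rho> \<pi>)) ` (P \<times> P))"
  have ne: "(\<lambda>(\<rho>, \<pi>). norm (h \<rho> \<pi>)) ` (P \<times> P) \<noteq> {}" using assms by auto
  have m: "norm (h \<rho> \<pi>) \<le> m" if "\<rho> \<in> P" "\<pi> \<in> P" for \<rho> \<pi>
    unfolding m_def using fin that by (intro Max_ge) auto
  have m0: "0 \<le> m" using m[OF assms(8,9)] by (rule order.trans[rotated]) simp
  have dev: "norm (h \<rho> \<pi> - B \<rho> \<pi>) \<le> real (card P) * \<epsilon> * m" if "\<rho> \<in> P" "\<pi> \<in> P" for \<rho> \<pi>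
  proof -
    have "B \<rho> \<pi> = h \<rho> \<pi> + (\<Sum>\<pi>'\<in>P-{\<rho>}. G \<rho> \<pi>' * h \<pi>' \<pi>)"
      using sum.remove[OF fin that(1), of "\<lambda>\<pi>'. G \<rho> \<pi>' * h \<pi>' \<pi>"] sys[OF that] G1[OF that(1)] by simp
    then have "norm (h \<rho> \<pi> - B \<rho> \<pi>) = norm (\<Sum>\<pi>'\<in>P-{\<rho>}. G \<rho> \<pi>' * h \<pi>' \<pi>)"
      by (simp add: norm_minus_commute)
    also have "\<dots> \<le> (\<Sum>\<pi>'\<in>P-{\<rho>}. \<epsilon> * m)"
      using that m G2 \<epsilon> by (intro sum_norm_le) (auto simp: norm_mult intro!: mult_mono)
    also have "\<dots> \<le> real (card P) * (\<epsilon> * m)"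
      using \<epsilon> m0 fin by (auto intro!: mult_right_mono card_mono)
    finally show ?thesis by (simp add: mult.assoc)
  qed
  have "m \<in> (\<lambda>(\<rho>, \<pi>). norm (h \<rho> \<pi>)) ` (P \<times> P)"
    unfolding m_def using fin ne by (intro Max_in) auto
  then obtain \<rho>0 \<pi>0 where 0: "\<rho>0 \<in> P" "\<pi>0 \<in> P" "m = norm (h \<rho>0 \<pi>0)" by auto
  have "m \<le> norm (B \<rho>0 \<pi>0) + norm (h \<rho>0 \<pi>0 - B \<rho>0 \<pi>0)"
    unfolding 0(3) using norm_triangle_sub by blast
  also have "\<dots> \<le> 1 + real (card P) * \<epsilon> * m" using B1 dev 0 by (intro add_mono) auto
  also have "\<dots> \<le> 1 + m / 2"
  proof -
    have "real (card P) * \<epsilon> \<le> 1 / 2" using \<epsilon>(2) by simp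
    then have "real (card P) * \<epsilon> * m \<le> 1 / 2 * m" using m0 by (rule mult_right_mono)
    then show ?thesis by simp
  qed
  finally have "m \<le> 2" by simp
  then have "real (card P) * \<epsilon> * m \<le> real (card P) * \<epsilon> * 2" using \<epsilon> by (intro mult_left_mono) auto
  with dev[OF assms(8,9)] show ?thesis by simp
qed

lemma index_funs_comp_colour_perm:
  assumes "a \<in> index_funs n d" "\<pi> \<in> colour_perms n clr"
  shows "a \<circ> \<pi> \<in> index_funs n d"
  using assms by (intro index_funs_comp) (auto simp: colour_perms_def)

text \<open>Here the column tuples depend on the row tuples. The expansion forces \<open>c\<close>
  to be \<open>a \<circ> \<pi>\<close>, and the weights summed over \<open>a\<close> again solve a
  linear system, whose right-hand side consists of entries of the same coincidence matrix.\<close>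

lemma joint_moment_cycle_sum_bound:
  assumes clr: "\<forall>t<n. clr t < g" and haar: "is_haar_unitary d \<mu>"
    and \<sigma>: "\<sigma> permutes {..<n}" and \<tau>: "\<tau> permutes {..<n}"
    and d: "4 * n < d" "2 * card (colour_perms n clr) \<le> d"
  shows "norm ((\<Sum>a\<in>index_funs n d. \<Sum>c\<in>index_funs n d. joint_moment n g clr \<mu> (a \<circ> \<sigma>) (c \<circ> \<tau>) a c) -
      of_nat (card {\<pi> \<in> colour_perms n clr. \<sigma> \<circ> \<pi> = \<pi> \<circ> \<tau>}))
    \<le> real (card (colour_perms n clr)) * (2 * real (card (colour_perms n clr)) + 1) / d"
proof -
  let ?P = "colour_perms n clr" and ?I = "index_funs n d"
  define F where "F b e = joint_moment n g clr \<mu> b e" for b e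
  define N where "N x y = card {a \<in> ?I. a \<circ> x = a \<circ> y}" for x y :: "nat \<Rightarrow> nat"
  have perm: "\<pi> permutes {..<n}" if "\<pi> \<in> ?P" for \<pi>
    using that by (simp add: colour_perms_def)
  note comp = index_funs_comp_colour_perm
  have "\<exists>f. \<forall>a\<in>?I. \<forall>c\<in>?I. F b e a c = (\<Sum>\<pi> | \<pi> \<in> ?P \<and> a \<circ> \<pi> = c. f \<pi>)"
    if "b \<in> ?I" "e \<in> ?I" for b e
  proof (rule exchange_expansion[where F = "F b e" and n = n and d = d and clr = clr, OF _ d(1)])
    show "F b e a c = (\<Sum>t | t < n \<and> clr t = clr s \<and> a t = c s. F b e (a(t := q)) (c(s := q)))"
      if "a \<in> ?I" "c \<in> ?I" "s < n" "q < d" "q \<notin> a ` {..<n}" "q \<notin> c ` {..<n}" for a c s q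
      unfolding F_def by (rule joint_moment_exchange[OF clr haar \<open>b \<in> ?I\<close> \<open>e \<in> ?I\<close> that])
  qed blast
  note ex = this
  \<comment> \<open>One weight function is fixed for each pair of column tuples, as these vary in
    the sum.\<close>
  define f where "f b e = (SOME f. \<forall>a\<in>?I. \<forall>c\<in>?I. F b e a c = (\<Sum>\<pi> | \<pi> \<in> ?P \<and> a \<circ> \<pi> = c. f \<pi>))" for b e
  have "\<forall>a\<in>?I. \<forall>c\<in>?I. F b e a c = (\<Sum>\<pi> | \<pi> \<in> ?P \<and> a \<circ> \<pi> = c. f b e \<pi>)"
    if "b \<in> ?I" "e \<in> ?I" for b e
    unfolding f_def by (rule someI_ex[OF ex[OF that]])
  then have f: "F b e a c = (\<Sum>\<pi> | \<pi> \<in> ?P \<and> a \<circ> \<pi> = c. f b e \<pi>)"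
    if "b \<in> ?I" "e \<in> ?I" "a \<in> ?I" "c \<in> ?I" for b e a c
    using that by blast
  have weights: "(\<Sum>\<pi>'\<in>?P. of_nat (N \<rho> \<pi>') * f b e \<pi>') = (if b \<circ> \<rho> = e then 1 else 0)"
    if "b \<in> ?I" "e \<in> ?I" "\<rho> \<in> ?P" for b e \<rho>
  proof -
    have "(if b \<circ> \<rho> = e then 1 else 0) = (\<Sum>a\<in>?I. F b e a (a \<circ> \<rho>))"
      unfolding F_def using joint_moment_contraction[OF clr haar that] by simp
    also have "\<dots> = (\<Sum>a\<in>?I. \<Sum>\<pi>'\<in>?P. if a \<circ> \<pi>' = a \<circ> \<rho> then f b e \<pi>' else 0)"
    proof (rule sum.cong[OF refl])
      fix a assume "a \<in> ?I"
      then show "F b e a (a \<circ> \<rho>) = (\<Sum>\<pi>'\<in>?P. if a \<circ> \<pi>' = a \<circ> \<rho> then f b e \<pi>' else 0)"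
        unfolding f[OF that(1,2) \<open>a \<in> ?I\<close> comp[OF \<open>a \<in> ?I\<close> that(3)]]
        by (intro sum.inter_filter finite_colour_perms)
    qed
    also have "\<dots> = (\<Sum>\<pi>'\<in>?P. \<Sum>a\<in>?I. if a \<circ> \<pi>' = a \<circ> \<rho> then f b e \<pi>' else 0)"
      by (rule sum.swap)
    also have "\<dots> = (\<Sum>\<pi>'\<in>?P. of_nat (N \<rho> \<pi>') * f b e \<pi>')"
    proof (rule sum.cong[OF refl])
      fix \<pi>'
      have "(\<Sum>a\<in>?I. if a \<circ> \<pi>' = a \<circ> \<rho> then f b e \<pi>' else 0) = (\<Sum>a | a \<in> ?I \<and> a \<circ> \<pi>' = a \<circ> \<rho>. f b e \<pi>')"
        by (intro sum.inter_filter[symmetric] finite_index_funs)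
      also have "\<dots> = of_nat (card {a \<in> ?I. a \<circ> \<pi>' = a \<circ> \<rho>}) * f b e \<pi>'"
        by (rule sum_constant)
      also have "{a \<in> ?I. a \<circ> \<pi>' = a \<circ> \<rho>} = {a \<in> ?I. a \<circ> \<rho> = a \<circ> \<pi>'}" by metis
      finally show "(\<Sum>a\<in>?I. if a \<circ> \<pi>' = a \<circ> \<rho> then f b e \<pi>' else 0) = of_nat (N \<rho> \<pi>') * f b e \<pi>'"
        by (simp only: N_def)
    qed
    finally show ?thesis ..
  qed
  \<comment> \<open>The sum in question involves only \<open>h \<pi> \<pi>\<close>, but for a fixed
    second argument the system couples all first arguments.\<close>
  define h where "h \<pi>' \<pi> = (\<Sum>a\<in>?I. f (a \<circ> \<sigma>) (a \<circ> \<pi> \<circ> \<tau>) \<pi>')" for \<pi>' \<pi>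
  \<comment> \<open>The Gram matrix of Weingarten calculus, scaled to unit diagonal.\<close>
  define G where "G x y = complex_of_real (real (N x y) / real (d ^ n))" for x y
  have dn: "real (d ^ n) > 0" using d by simp
  have G1: "G x x = 1" for x
    using dn unfolding G_def N_def card_coincidences_refl by simp
  have G2: "norm (G x y) \<le> 1 / d" if "x permutes {..<n}" "y permutes {..<n}" "x \<noteq> y" for x y
  proof -
    have "real (N x y) * real d \<le> real (d ^ n)"
      unfolding N_def of_nat_mult[symmetric] of_nat_le_iff by (rule card_coincidences_le[OF that])
    then have "real (N x y) / real (d ^ n) \<le> 1 / d" using d dn by (simp add: field_simps)
    then show ?thesis by (simp add: G_def norm_divide norm_power)
  qed
  have d1: "1 / real d \<le> 1" using d by simp
  have G3: "norm (G x y) \<le> 1" if "x permutes {..<n}" "y permutes {..<n}" for x y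
    using G1[of x] G2[OF that] d1 by (cases "x = y") auto
  have sys: "(\<Sum>\<pi>'\<in>?P. G \<rho> \<pi>' * h \<pi>' \<pi>) = G (\<sigma> \<circ> \<rho>) (\<pi> \<circ> \<tau>)"
    if "\<rho> \<in> ?P" "\<pi> \<in> ?P" for \<rho> \<pi>
  proof -
    have "(\<Sum>\<pi>'\<in>?P. of_nat (N \<rho> \<pi>') * h \<pi>' \<pi>) =
      (\<Sum>a\<in>?I. \<Sum>\<pi>'\<in>?P. of_nat (N \<rho> \<pi>') * f (a \<circ> \<sigma>) (a \<circ> \<pi> \<circ> \<tau>) \<pi>')"
      unfolding h_def sum_distrib_left by (rule sum.swap)
    also have "\<dots> = (\<Sum>a\<in>?I. if a \<circ> \<sigma> \<circ> \<rho> = a \<circ> \<pi> \<circ> \<tau> then 1 else 0)"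
      using that \<sigma> \<tau> perm[OF that(2)] by (intro sum.cong refl weights index_funs_comp)
    also have "\<dots> = (\<Sum>a | a \<in> ?I \<and> a \<circ> \<sigma> \<circ> \<rho> = a \<circ> \<pi> \<circ> \<tau>. 1)"
      by (intro sum.inter_filter[symmetric] finite_index_funs)
    also have "\<dots> = of_nat (N (\<sigma> \<circ> \<rho>) (\<pi> \<circ> \<tau>))"
      unfolding N_def comp_assoc by (simp only: sum_constant mult_1_right)
    finally have "(\<Sum>\<pi>'\<in>?P. of_nat (N \<rho> \<pi>') * h \<pi>' \<pi>) / of_nat (d ^ n) =
      of_nat (N (\<sigma> \<circ> \<rho>) (\<pi> \<circ> \<tau>)) / of_nat (d ^ n)" by (rule arg_cong)
    then show ?thesis by (simp add: G_def sum_divide_distrib)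
  qed
  \<comment> \<open>Replacing \<open>h\<close> by the right-hand side of the system costs 2
    \<open>card P\<close> / d; replacing that entry of \<open>G\<close> by its limit costs another
    1/d.\<close>
  have bound: "norm (h \<pi> \<pi> - (if \<sigma> \<circ> \<pi> = \<pi> \<circ> \<tau> then 1 else 0)) \<le> (2 * real (card ?P) + 1) / d" if "\<pi> \<in> ?P" for \<pi>
  proof -
    have p: "\<sigma> \<circ> \<pi> permutes {..<n}" "\<pi> \<circ> \<tau> permutes {..<n}"
      using permutes_compose[OF perm[OF that] \<sigma>] permutes_compose[OF \<tau> perm[OF that]] .
    have "norm (h \<pi> \<pi> - G (\<sigma> \<circ> \<pi>) (\<pi> \<circ> \<tau>)) \<le> 2 * real (card ?P) * (1 / d)"
    proof (rule near_identity_system_bound[where G = G and h = h and P = ?P and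
          B = "\<lambda>\<rho> \<pi>. G (\<sigma> \<circ> \<rho>) (\<pi> \<circ> \<tau>)", OF finite_colour_perms sys G1 _ _ _ _ that that])
      show "norm (G \<rho> \<pi>) \<le> 1 / d" if "\<rho> \<in> ?P" "\<pi> \<in> ?P" "\<rho> \<noteq> \<pi>" for \<rho> \<pi>
        using that by (intro G2 perm)
      show "norm (G (\<sigma> \<circ> \<rho>) (\<pi> \<circ> \<tau>)) \<le> 1" if "\<rho> \<in> ?P" "\<pi> \<in> ?P" for \<rho> \<pi>
        using that by (intro G3 permutes_compose perm \<sigma> \<tau>)
      have "2 * real (card ?P) \<le> real d" using d(2) by linarith
      then show "2 * real (card ?P) * (1 / d) \<le> 1" using d by (simp add: field_simps)
      show "0 \<le> 1 / real d" by (rule divide_nonneg_nonneg) simp_all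
    qed
    moreover have "norm (G (\<sigma> \<circ> \<pi>) (\<pi> \<circ> \<tau>) - (if \<sigma> \<circ> \<pi> = \<pi> \<circ> \<tau> then 1 else 0)) \<le> 1 / d"
      using G1 G2[OF p] by (cases "\<sigma> \<circ> \<pi> = \<pi> \<circ> \<tau>") (simp_all only: if_True if_False, simp_all)
    ultimately show ?thesis
      using norm_triangle_le[of "h \<pi> \<pi> - G (\<sigma> \<circ> \<pi>) (\<pi> \<circ> \<tau>)"
          "G (\<sigma> \<circ> \<pi>) (\<pi> \<circ> \<tau>) - (if \<sigma> \<circ> \<pi> = \<pi> \<circ> \<tau> then 1 else 0)" "(2 * real (card ?P) + 1) / d"]
      by (simp only: diff_add_cancel add_diff_eq add_divide_distrib mult_1_right times_divide_eq_right)
  qed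
  have "(\<Sum>a\<in>?I. \<Sum>c\<in>?I. F (a \<circ> \<sigma>) (c \<circ> \<tau>) a c) = (\<Sum>\<pi>\<in>?P. h \<pi> \<pi>)"
  proof -
    have "(\<Sum>a\<in>?I. \<Sum>c\<in>?I. F (a \<circ> \<sigma>) (c \<circ> \<tau>) a c) =
      (\<Sum>a\<in>?I. \<Sum>c\<in>?I. \<Sum>\<pi>\<in>?P. if a \<circ> \<pi> = c then f (a \<circ> \<sigma>) (c \<circ> \<tau>) \<pi> else 0)"
    proof (intro sum.cong refl)
      fix a c assume ac: "a \<in> ?I" "c \<in> ?I"
      show "F (a \<circ> \<sigma>) (c \<circ> \<tau>) a c = (\<Sum>\<pi>\<in>?P. if a \<circ> \<pi> = c then f (a \<circ> \<sigma>) (c \<circ> \<tau>) \<pi> else 0)"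
        unfolding f[OF index_funs_comp[OF ac(1) \<sigma>] index_funs_comp[OF ac(2) \<tau>] ac]
        by (intro sum.inter_filter finite_colour_perms)
    qed
    also have "\<dots> = (\<Sum>a\<in>?I. \<Sum>\<pi>\<in>?P. \<Sum>c\<in>?I. if a \<circ> \<pi> = c then f (a \<circ> \<sigma>) (c \<circ> \<tau>) \<pi> else 0)"
      by (intro sum.cong refl sum.swap)
    also have "\<dots> = (\<Sum>a\<in>?I. \<Sum>\<pi>\<in>?P. f (a \<circ> \<sigma>) (a \<circ> \<pi> \<circ> \<tau>) \<pi>)"
    proof (intro sum.cong refl)
      fix a \<pi> assume "a \<in> ?I" "\<pi> \<in> ?P"
      then have "a \<circ> \<pi> \<in> ?I" by (rule comp)
      then show "(\<Sum>c\<in>?I. if a \<circ> \<pi> = c then f (a \<circ> \<sigma>) (c \<circ> \<tau>) \<pi> else 0) = f (a \<circ> \<sigma>) (a \<circ> \<pi> \<circ> \<tau>) \<pi>"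
        by (simp only: sum.delta'[OF finite_index_funs] if_True)
    qed
    also have "\<dots> = (\<Sum>\<pi>\<in>?P. h \<pi> \<pi>)"
      unfolding h_def by (rule sum.swap)
    finally show ?thesis .
  qed
  moreover have "of_nat (card {\<pi> \<in> ?P. \<sigma> \<circ> \<pi> = \<pi> \<circ> \<tau>}) = (\<Sum>\<pi>\<in>?P. if \<sigma> \<circ> \<pi> = \<pi> \<circ> \<tau> then 1 else (0::complex))"
    by (simp only: sum.inter_filter[OF finite_colour_perms, symmetric] sum_constant mult_1_right)
  ultimately have "norm ((\<Sum>a\<in>?I. \<Sum>c\<in>?I. F (a \<circ> \<sigma>) (c \<circ> \<tau>) a c) - of_nat (card {\<pi> \<in> ?P. \<sigma> \<circ> \<pi> = \<pi> \<circ> \<tau>})) =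
      norm (\<Sum>\<pi>\<in>?P. h \<pi> \<pi> - (if \<sigma> \<circ> \<pi> = \<pi> \<circ> \<tau> then 1 else 0))"
    by (simp only: sum_subtractf)
  also have "\<dots> \<le> (\<Sum>\<pi>\<in>?P. (2 * real (card ?P) + 1) / d)"
    by (rule sum_norm_le) (rule bound)
  also have "\<dots> = real (card ?P) * (2 * real (card ?P) + 1) / d"
    by simp
  finally show ?thesis unfolding F_def .
qed

section \<open>Trace polynomials in coordinates\<close>

lemma tensor_mats_carrier:
  assumes "\<And>A. A \<in> set As \<Longrightarrow> A \<in> carrier_mat m m"
  shows "tensor_mats As \<in> carrier_mat (m ^ length As) (m ^ length As)"
  using assms
proof (induction As)
  case Nil
  then show ?case by (simp add: tensor_mats_def)
next
  case (Cons A As)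
  then have "tensor_mats As \<in> carrier_mat (m ^ length As) (m ^ length As)" "A \<in> carrier_mat m m"
    by auto
  then show ?case by (intro carrier_matI) (auto simp: tensor_mats_def tensor_mat_def)
qed

lemma tensor_mats_index:
  assumes "\<And>A. A \<in> set As \<Longrightarrow> A \<in> carrier_mat m m" "i < m ^ length As" "j < m ^ length As"
  shows "tensor_mats As $$ (i, j) =
    (\<Prod>t<length As. As ! t $$ (tensor_digit m (length As) i t, tensor_digit m (length As) j t))"
  using assms
proof (induction As arbitrary: i j)
  case Nil
  then show ?case by (simp add: tensor_mats_def)
next
  case (Cons A As)
  let ?M = "m ^ length As"
  have T: "tensor_mats As \<in> carrier_mat ?M ?M" and A: "A \<in> carrier_mat m m"
    using Cons.prems tensor_mats_carrier[of As m] by auto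
  have pos: "i mod ?M < ?M" "j mod ?M < ?M"
    using Cons.prems by (cases m; auto simp: power_0_left)+
  have "tensor_mats (A # As) $$ (i, j) = A $$ (i div ?M, j div ?M) * tensor_mats As $$ (i mod ?M, j mod ?M)"
    using Cons.prems(2,3) carrier_matD[OF T] carrier_matD[OF A]
    by (simp add: tensor_mats_def tensor_mat_def)
  also have "\<dots> = A $$ (i div ?M, j div ?M) *
      (\<Prod>t<length As. As ! t $$ (tensor_digit m (length As) (i mod ?M) t, tensor_digit m (length As) (j mod ?M) t))"
    using Cons pos by auto
  also have "\<dots> = (\<Prod>t<length (A # As). (A # As) ! t $$
      (tensor_digit m (length (A # As)) i t, tensor_digit m (length (A # As)) j t))"
    using Cons.prems(2,3)
    by (simp only: length_Cons prod.lessThan_Suc_shift)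
       (simp add: tensor_digit_0[simplified] tensor_digit_Suc)
  finally show ?case .
qed

text \<open>Entry t is the index of the matrix in tensor factor t of \<open>tensor_power_mi\<close>;
  read as a function of t, it is the colouring of positions induced by \<alpha>.\<close>

definition colour_list :: "nat \<Rightarrow> (nat \<Rightarrow> nat) \<Rightarrow> nat list" where
  "colour_list g \<alpha> = concat (map (\<lambda>j. replicate (\<alpha> j) j) [0..<g])"

lemma length_colour_list: "length (colour_list g \<alpha>) = (\<Sum>j<g. \<alpha> j)"
  by (induction g) (auto simp: colour_list_def)

lemma colour_list_less: "t < length (colour_list g \<alpha>) \<Longrightarrow> colour_list g \<alpha> ! t < g"
  using nth_mem[of t "colour_list g \<alpha>"] by (auto simp: colour_list_def)

lemma card_colour_list:
  assumes "j < g"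
  shows "card {t. t < length (colour_list g \<alpha>) \<and> colour_list g \<alpha> ! t = j} = \<alpha> j"
proof -
  have "length (filter (\<lambda>i. i = j) (colour_list g \<alpha>)) = (if j < g then \<alpha> j else 0)"
    by (induction g) (auto simp: colour_list_def less_Suc_eq)
  then show ?thesis using assms by (simp add: length_filter_conv_card)
qed

text \<open>This turns sums over numbered basis vectors into sums over index tuples.\<close>

lemma bij_betw_tensor_digits:
  "bij_betw (\<lambda>i. \<lambda>t\<in>{..<n}. tensor_digit m n i t) {..<m ^ n} (index_funs n m)"
proof (rule bij_betw_imageI)
  have dig: "(\<lambda>t\<in>{..<n}. tensor_digit m n i t) \<in> index_funs n m" if "i < m ^ n" for i
    unfolding index_funs_def restrict_PiE_iff using that by (simp add: tensor_digit_less)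
  show "inj_on (\<lambda>i. \<lambda>t\<in>{..<n}. tensor_digit m n i t) {..<m ^ n}"
  proof (rule inj_onI)
    fix i j assume i: "i \<in> {..<m ^ n}" and j: "j \<in> {..<m ^ n}"
      and eq: "(\<lambda>t\<in>{..<n}. tensor_digit m n i t) = (\<lambda>t\<in>{..<n}. tensor_digit m n j t)"
    show "i = j"
    proof (rule tensor_digits_inj)
      fix t assume "t < n"
      then show "tensor_digit m n i t = tensor_digit m n j t" using fun_cong[OF eq, of t] by simp
    qed (use i j in auto)
  qed
  show "(\<lambda>i. \<lambda>t\<in>{..<n}. tensor_digit m n i t) ` {..<m ^ n} = index_funs n m"
  proof (intro equalityI subsetI)
    fix a assume "a \<in> (\<lambda>i. \<lambda>t\<in>{..<n}. tensor_digit m n i t) ` {..<m ^ n}"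
    then show "a \<in> index_funs n m"
      using dig by blast
  next
    fix a assume a: "a \<in> index_funs n m"
    obtain i where i: "i < m ^ n" "\<forall>t<n. tensor_digit m n i t = a t"
      using tensor_digits_surj[of n a m] index_funs_less[OF a] by blast
    have "a = (\<lambda>t\<in>{..<n}. tensor_digit m n i t)"
      using i(2) by (intro index_funs_eqI[OF a dig[OF i(1)]]) auto
    then show "a \<in> (\<lambda>i. \<lambda>t\<in>{..<n}. tensor_digit m n i t) ` {..<m ^ n}" using i(1) by blast
  qed
qed

text \<open>The trace is the sum of \<open>R $$ (i, j) * T $$ (j, i)\<close>, and the permutation
  matrix \<open>R\<close> keeps only the pairs in which the digits of i are those of j composed with
  \<sigma>. The digits of j thus become the rows \<open>a\<close> and those of i the
  columns.\<close>

lemma trace_poly_eq: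
  assumes A: "\<And>j. j < g \<Longrightarrow> A j \<in> carrier_mat m m"
    and n: "(\<Sum>j<g. \<alpha> j) = n" and \<sigma>: "\<sigma> permutes {..<n}"
  shows "trace_poly m g \<sigma> \<alpha> A = (\<Sum>a\<in>index_funs n m. colour_word n ((!) (colour_list g \<alpha>)) A a (a \<circ> \<sigma>))"
proof -
  let ?clr = "(!) (colour_list g \<alpha>)" and ?dig = "\<lambda>i. \<lambda>t\<in>{..<n}. tensor_digit m n i t"
  define T where "T = tensor_power_mi g A \<alpha>"
  define R where "R = perm_op m n (Hilbert_Choice.inv \<sigma>)"
  have T_def': "T = tensor_mats (map A (colour_list g \<alpha>))"
    by (simp add: T_def tensor_power_mi_def colour_list_def map_concat comp_def)
  have As: "M \<in> carrier_mat m m" if "M \<in> set (map A (colour_list g \<alpha>))" for M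
    using that A by (auto simp: colour_list_def)
  have len: "length (map A (colour_list g \<alpha>)) = n" by (simp add: length_colour_list n)
  have T: "T \<in> carrier_mat (m ^ n) (m ^ n)"
    unfolding T_def' using tensor_mats_carrier[of "map A (colour_list g \<alpha>)" m, OF As] len by simp
  have Tij: "T $$ (i, j) = colour_word n ?clr A (?dig i) (?dig j)" if "i < m ^ n" "j < m ^ n" for i j
    using tensor_mats_index[of "map A (colour_list g \<alpha>)" m i j, OF As] that len
    by (auto simp: T_def' colour_word_def intro!: prod.cong)
  have R: "R \<in> carrier_mat (m ^ n) (m ^ n)" by (simp add: R_def perm_op_def)
  \<comment> \<open>\<open>trace_poly\<close> inverts \<sigma> and \<open>perm_op\<close> inverts
    once more, so \<sigma> itself acts on the digits.\<close>
  have invinv: "Hilbert_Choice.inv (Hilbert_Choice.inv \<sigma>) = \<sigma>"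
    by (rule permutes_inv_inv[OF \<sigma>])
  have dig: "?dig i \<in> index_funs n m" if "i < m ^ n" for i
    using that bij_betw_apply[OF bij_betw_tensor_digits] by simp
  have Rij: "R $$ (i, j) = (if ?dig i = ?dig j \<circ> \<sigma> then 1 else 0)" if "i < m ^ n" "j < m ^ n" for i j
  proof -
    have "(\<forall>t<n. tensor_digit m n i t = tensor_digit m n j (\<sigma> t)) \<longleftrightarrow> ?dig i = ?dig j \<circ> \<sigma>"
    proof
      assume eq: "\<forall>t<n. tensor_digit m n i t = tensor_digit m n j (\<sigma> t)"
      show "?dig i = ?dig j \<circ> \<sigma>"
      proof (rule index_funs_eqI[OF dig index_funs_comp[OF dig \<sigma>]])
        fix t assume "t < n"
        then show "?dig i t = (?dig j \<circ> \<sigma>) t"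
          using eq permutes_in_image[OF \<sigma>, of t] by simp
      qed (use that in auto)
    next
      assume eq: "?dig i = ?dig j \<circ> \<sigma>"
      show "\<forall>t<n. tensor_digit m n i t = tensor_digit m n j (\<sigma> t)"
      proof (intro allI impI)
        fix t assume "t < n"
        then show "tensor_digit m n i t = tensor_digit m n j (\<sigma> t)"
          using fun_cong[OF eq, of t] permutes_in_image[OF \<sigma>, of t] by simp
      qed
    qed
    then show ?thesis using that by (simp add: R_def perm_op_def invinv)
  qed
  have "trace_poly m g \<sigma> \<alpha> A = (\<Sum>i<m ^ n. \<Sum>j<m ^ n. R $$ (i, j) * T $$ (j, i))"
    using R T by (simp add: trace_poly_def mat_tr_def n index_mult_mat_sum[OF R T]
        del: index_mult_mat(1) flip: R_def T_def)
  also have "\<dots> = (\<Sum>j<m ^ n. \<Sum>i<m ^ n. R $$ (i, j) * T $$ (j, i))"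
    by (rule sum.swap)
  also have "\<dots> = (\<Sum>j<m ^ n. \<Sum>i<m ^ n. if ?dig i = ?dig j \<circ> \<sigma> then colour_word n ?clr A (?dig j) (?dig i) else 0)"
    by (intro sum.cong refl) (simp only: lessThan_iff Rij Tij, simp)
  also have "\<dots> = (\<Sum>j<m ^ n. \<Sum>c\<in>index_funs n m. if c = ?dig j \<circ> \<sigma> then colour_word n ?clr A (?dig j) c else 0)"
    by (intro sum.cong refl sum.reindex_bij_betw[OF bij_betw_tensor_digits,
        of "\<lambda>c. if c = ?dig _ \<circ> \<sigma> then colour_word n ?clr A (?dig _) c else 0"])
  also have "\<dots> = (\<Sum>a\<in>index_funs n m. \<Sum>c\<in>index_funs n m. if c = a \<circ> \<sigma> then colour_word n ?clr A a c else 0)"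
    by (rule sum.reindex_bij_betw[OF bij_betw_tensor_digits,
        of "\<lambda>a. \<Sum>c\<in>index_funs n m. if c = a \<circ> \<sigma> then colour_word n ?clr A a c else 0"])
  also have "\<dots> = (\<Sum>a\<in>index_funs n m. colour_word n ?clr A a (a \<circ> \<sigma>))"
  proof (rule sum.cong[OF refl])
    fix a assume "a \<in> index_funs n m"
    then have "a \<circ> \<sigma> \<in> index_funs n m" using \<sigma> by (rule index_funs_comp)
    then show "(\<Sum>c\<in>index_funs n m. if c = a \<circ> \<sigma> then colour_word n ?clr A a c else 0) =
        colour_word n ?clr A a (a \<circ> \<sigma>)"
      by (simp only: sum.delta[OF finite_index_funs] if_True)
  qed
  finally show ?thesis .
qed

lemma colour_word_comp:
  assumes "\<pi> \<in> colour_perms n clr"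
  shows "colour_word n clr A (a \<circ> \<pi>) (b \<circ> \<pi>) = colour_word n clr A a b"
proof -
  have perm: "\<pi> permutes {..<n}" and cl: "\<And>t. t < n \<Longrightarrow> clr (\<pi> t) = clr t"
    using assms by (auto simp: colour_perms_def)
  show ?thesis unfolding colour_word_def using cl
    by (subst (2) prod.permute[OF perm]) simp
qed

text \<open>Such a \<pi> only permutes tensor factors that hold the same matrix; in coordinates, it
  is absorbed by substituting \<open>b \<circ> \<pi>\<close> for the summation tuple.\<close>

lemma trace_poly_conjugate:
  assumes A: "\<And>j. j < g \<Longrightarrow> A j \<in> carrier_mat m m"
    and n: "(\<Sum>j<g. \<alpha> j) = n" and \<sigma>: "\<sigma> permutes {..<n}"
    and \<pi>: "\<pi> \<in> colour_perms n ((!) (colour_list g \<alpha>))"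
  shows "trace_poly m g (Hilbert_Choice.inv \<pi> \<circ> \<sigma> \<circ> \<pi>) \<alpha> A = trace_poly m g \<sigma> \<alpha> A"
proof -
  let ?W = "colour_word n ((!) (colour_list g \<alpha>)) A"
  have perm: "\<pi> permutes {..<n}" using \<pi> by (simp add: colour_perms_def)
  note inv = permutes_inv[OF perm]
  have conj: "Hilbert_Choice.inv \<pi> \<circ> \<sigma> \<circ> \<pi> permutes {..<n}"
    by (intro permutes_compose perm \<sigma> inv)
  have "(\<Sum>a\<in>index_funs n m. ?W a (a \<circ> (Hilbert_Choice.inv \<pi> \<circ> \<sigma> \<circ> \<pi>))) = (\<Sum>b\<in>index_funs n m. ?W b (b \<circ> \<sigma>))"
  proof (rule sum.reindex_bij_witness[where i = "\<lambda>b. b \<circ> \<pi>" and j = "\<lambda>a. a \<circ> Hilbert_Choice.inv \<pi>"])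
    fix a assume a: "a \<in> index_funs n m"
    show "a \<circ> Hilbert_Choice.inv \<pi> \<circ> \<pi> = a"
      by (simp only: comp_assoc permutes_inv_o(2)[OF perm] comp_id)
    show "a \<circ> Hilbert_Choice.inv \<pi> \<in> index_funs n m" using a inv by (rule index_funs_comp)
    have "?W (a \<circ> Hilbert_Choice.inv \<pi>) (a \<circ> Hilbert_Choice.inv \<pi> \<circ> \<sigma>) =
      ?W (a \<circ> Hilbert_Choice.inv \<pi> \<circ> \<pi>) (a \<circ> Hilbert_Choice.inv \<pi> \<circ> \<sigma> \<circ> \<pi>)"
      by (rule colour_word_comp[OF \<pi>, symmetric])
    also have "a \<circ> Hilbert_Choice.inv \<pi> \<circ> \<pi> = a" by fact
    finally show "?W (a \<circ> Hilbert_Choice.inv \<pi>) (a \<circ> Hilbert_Choice.inv \<pi> \<circ> \<sigma>) =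
      ?W a (a \<circ> (Hilbert_Choice.inv \<pi> \<circ> \<sigma> \<circ> \<pi>))" by (simp only: comp_assoc)
  next
    fix b assume b: "b \<in> index_funs n m"
    show "b \<circ> \<pi> \<circ> Hilbert_Choice.inv \<pi> = b"
      by (simp only: comp_assoc permutes_inv_o(1)[OF perm] comp_id)
    show "b \<circ> \<pi> \<in> index_funs n m" using b perm by (rule index_funs_comp)
  qed
  then show ?thesis
    by (simp only: trace_poly_eq[OF A n conj] trace_poly_eq[OF A n \<sigma>])
qed

section \<open>The order of a Young subgroup\<close>

lemma permutes_if_in:
  assumes "inj f" "finite S" "f ` S \<subseteq> S"
  shows "(\<lambda>t. if t \<in> S then f t else t) permutes S"
proof (rule bij_imp_permutes)
  have "f ` S = S" using assms by (intro endo_inj_surj) (auto intro: inj_on_subset)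
  then show "bij_betw (\<lambda>t. if t \<in> S then f t else t) S S"
    using assms(1) by (auto simp: bij_betw_def inj_on_def inj_def)
qed simp

text \<open>Induction on the colours: splitting off the class \<open>A\<close> of colour j writes
  the group as the product of the symmetric group of \<open>A\<close> and the colour-preserving
  group of the rest.\<close>

lemma card_permutes_preserving:
  fixes clr :: "'a \<Rightarrow> 'b"
  assumes "finite C" "finite S" "clr ` S \<subseteq> C"
  shows "card {\<pi>. \<pi> permutes S \<and> (\<forall>t\<in>S. clr (\<pi> t) = clr t)} = (\<Prod>j\<in>C. fact (card {t \<in> S. clr t = j}))"
  using assms
proof (induction C arbitrary: S rule: finite_induct)
  case empty
  then show ?case by simp
next
  case (insert j C S)
  define A where "A = {t \<in> S. clr t = j}"
  define S' where "S' = S - A"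
  define P where "P X = {\<pi>. \<pi> permutes X \<and> (\<forall>t\<in>X. clr (\<pi> t) = clr t)}" for X
  have fin: "finite A" "finite S'" and sub: "A \<subseteq> S" "S' \<subseteq> S" and disj: "A \<inter> S' = {}"
    using insert.prems by (auto simp: A_def S'_def)
  let ?r = "\<lambda>X \<pi> t. if t \<in> X then \<pi> t else (t :: 'a)"
  \<comment> \<open>A colour-preserving permutation maps \<open>A\<close> and \<open>S'\<close> to
    themselves, so restriction to the two parts inverts composition.\<close>
  have "bij_betw (\<lambda>(\<pi>, \<pi>'). \<pi> \<circ> \<pi>') ({\<pi>. \<pi> permutes A} \<times> P S') (P S)"
  proof (rule bij_betw_byWitness[where f' = "\<lambda>\<pi>. (?r A \<pi>, ?r S' \<pi>)"])
    show "\<forall>x\<in>{\<pi>. \<pi> permutes A} \<times> P S'. (?r A (case x of (\<pi>, \<pi>') \<Rightarrow> \<pi> \<circ> \<pi>'), ?r S' (case x of (\<pi>, \<pi>') \<Rightarrow> \<pi> \<circ> \<pi>')) = x"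
    proof clarify
      fix \<pi> \<pi>' assume p: "\<pi> permutes A" and "\<pi>' \<in> P S'"
      then have p': "\<pi>' permutes S'" by (simp add: P_def)
      have "?r A (\<pi> \<circ> \<pi>') t = \<pi> t" "?r S' (\<pi> \<circ> \<pi>') t = \<pi>' t" for t
        using disj permutes_in_image[OF p', of t] permutes_not_in[OF p', of t]
          permutes_not_in[OF p, of t] permutes_not_in[OF p, of "\<pi>' t"]
        by (auto simp: disjoint_iff)
      then show "?r A (\<pi> \<circ> \<pi>') = \<pi> \<and> ?r S' (\<pi> \<circ> \<pi>') = \<pi>'" by blast
    qed
    show "\<forall>\<pi>\<in>P S. (case (?r A \<pi>, ?r S' \<pi>) of (\<pi>, \<pi>') \<Rightarrow> \<pi> \<circ> \<pi>') = \<pi>"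
    proof
      fix \<pi> assume "\<pi> \<in> P S"
      then have p: "\<pi> permutes S" and cl: "\<And>t. t \<in> S \<Longrightarrow> clr (\<pi> t) = clr t" by (auto simp: P_def)
      have "?r A \<pi> (?r S' \<pi> t) = \<pi> t" for t
        using cl[of t] permutes_in_image[OF p, of t] permutes_not_in[OF p, of t]
        by (auto simp: A_def S'_def)
      then show "(case (?r A \<pi>, ?r S' \<pi>) of (\<pi>, \<pi>') \<Rightarrow> \<pi> \<circ> \<pi>') = \<pi>" by (simp add: fun_eq_iff)
    qed
    show "(\<lambda>(\<pi>, \<pi>'). \<pi> \<circ> \<pi>') ` ({\<pi>. \<pi> permutes A} \<times> P S') \<subseteq> P S"
    proof clarify
      fix \<pi> \<pi>' assume p: "\<pi> permutes A" and "\<pi>' \<in> P S'"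
      then have p': "\<pi>' permutes S'" and cl: "\<And>t. t \<in> S' \<Longrightarrow> clr (\<pi>' t) = clr t" by (auto simp: P_def)
      have "\<pi> \<circ> \<pi>' permutes S"
        using p p' sub by (intro permutes_compose) (auto intro: permutes_subset)
      moreover have "clr (\<pi> (\<pi>' t)) = clr t" if "t \<in> S" for t
      proof (cases "t \<in> A")
        case True
        then have "\<pi>' t = t" "\<pi> t \<in> A"
          using disj permutes_not_in[OF p', of t] permutes_in_image[OF p, of t] by auto
        then show ?thesis using True by (auto simp: A_def)
      next
        case False
        then have "t \<in> S'" using that by (simp add: S'_def)
        then have "\<pi>' t \<in> S'" using permutes_in_image[OF p', of t] by simp
        then have "\<pi> (\<pi>' t) = \<pi>' t" using disj permutes_not_in[OF p] by auto
        then show ?thesis using cl \<open>t \<in> S'\<close> by simp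
      qed
      ultimately show "\<pi> \<circ> \<pi>' \<in> P S" by (simp add: P_def)
    qed
    show "(\<lambda>\<pi>. (?r A \<pi>, ?r S' \<pi>)) ` P S \<subseteq> {\<pi>. \<pi> permutes A} \<times> P S'"
    proof (rule image_subsetI)
      fix \<pi> assume "\<pi> \<in> P S"
      then have p: "\<pi> permutes S" and cl: "\<And>t. t \<in> S \<Longrightarrow> clr (\<pi> t) = clr t" by (auto simp: P_def)
      have "\<pi> ` A \<subseteq> A" "\<pi> ` S' \<subseteq> S'"
        using cl permutes_in_image[OF p] by (auto simp: A_def S'_def)
      then have "?r A \<pi> permutes A" "?r S' \<pi> permutes S'"
        using fin permutes_inj[OF p] by (auto intro!: permutes_if_in)
      then show "(?r A \<pi>, ?r S' \<pi>) \<in> {\<pi>. \<pi> permutes A} \<times> P S'"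
        using cl sub by (auto simp: P_def)
    qed
  qed
  then have "card (P S) = card ({\<pi>. \<pi> permutes A} \<times> P S')"
    by (rule bij_betw_same_card[symmetric])
  also have "\<dots> = fact (card A) * card (P S')"
    using card_permutations[OF refl fin(1)] by (simp add: card_cartesian_product)
  also have "card (P S') = (\<Prod>i\<in>C. fact (card {t \<in> S'. clr t = i}))"
    unfolding P_def using insert.prems fin by (intro insert.IH) (auto simp: A_def S'_def)
  also have "\<dots> = (\<Prod>i\<in>C. fact (card {t \<in> S. clr t = i}))"
    using insert.hyps
    by (intro prod.cong refl arg_cong[where f = "\<lambda>X. fact (card X)"]) (auto simp: A_def S'_def)
  finally show ?case
    using insert.hyps by (simp add: P_def A_def)
qed

text \<open>The multinomial coefficient is the index of the Young subgroup in the symmetric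
  group.\<close>

lemma multinom_times_card_colour_perms:
  assumes "\<alpha> \<in> multi_indices g n"
  shows "multinom g n \<alpha> * of_nat (card (colour_perms n ((!) (colour_list g \<alpha>)))) = fact n"
proof -
  have n: "n = length (colour_list g \<alpha>)"
    using assms by (simp add: multi_indices_def length_colour_list)
  have "card (colour_perms n ((!) (colour_list g \<alpha>))) =
      (\<Prod>j<g. fact (card {t \<in> {..<n}. colour_list g \<alpha> ! t = j}))"
    unfolding colour_perms_def Ball_def[symmetric] lessThan_iff[symmetric]
    by (rule card_permutes_preserving) (auto simp: n colour_list_less)
  also have "\<dots> = (\<Prod>j<g. fact (\<alpha> j))"
    using card_colour_list[of _ g \<alpha>] by (intro prod.cong refl) (simp add: n)
  finally show ?thesis by (simp add: multinom_def)
qed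

section \<open>Asymptotic orthogonality\<close>

text \<open>Each pair of \<sigma> and \<pi> admits exactly one \<tau>, the conjugate of \<sigma> by
  \<pi>. It has the sign of \<sigma>, so the signs cancel, and \<open>q\<close> takes the same value
  on it; hence every \<pi> in P contributes the same amount.\<close>

lemma sum_conjugation_pairs:
  fixes p q :: "(nat \<Rightarrow> nat) \<Rightarrow> complex"
  assumes q: "\<And>\<sigma> \<pi>. \<sigma> permutes {..<n} \<Longrightarrow> \<pi> \<in> colour_perms n clr \<Longrightarrow>
      q (Hilbert_Choice.inv \<pi> \<circ> \<sigma> \<circ> \<pi>) = q \<sigma>"
  shows "(\<Sum>\<sigma>\<in>{\<sigma>. \<sigma> permutes {..<n}}. \<Sum>\<tau>\<in>{\<tau>. \<tau> permutes {..<n}}.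
      of_int (sign \<sigma>) * of_int (sign \<tau>) * p \<sigma> * cnj (q \<tau>) *
      of_nat (card {\<pi> \<in> colour_perms n clr. \<sigma> \<circ> \<pi> = \<pi> \<circ> \<tau>})) =
    of_nat (card (colour_perms n clr)) * (\<Sum>\<sigma>\<in>{\<sigma>. \<sigma> permutes {..<n}}. p \<sigma> * cnj (q \<sigma>))"
proof -
  let ?P = "colour_perms n clr" and ?S = "{\<sigma>. \<sigma> permutes {..<n}}"
  define w where "w \<sigma> \<tau> = of_int (sign \<sigma>) * of_int (sign \<tau>) * p \<sigma> * cnj (q \<tau>)" for \<sigma> \<tau>
  have fin: "finite ?S" by (simp add: finite_permutations)
  have "(\<Sum>\<sigma>\<in>?S. \<Sum>\<tau>\<in>?S. w \<sigma> \<tau> * of_nat (card {\<pi> \<in> ?P. \<sigma> \<circ> \<pi> = \<pi> \<circ> \<tau>})) =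
    (\<Sum>\<sigma>\<in>?S. \<Sum>\<tau>\<in>?S. \<Sum>\<pi>\<in>?P. if \<tau> = Hilbert_Choice.inv \<pi> \<circ> \<sigma> \<circ> \<pi> then w \<sigma> \<tau> else 0)"
  proof (intro sum.cong refl)
    fix \<sigma> \<tau>
    have eq: "(\<sigma> \<circ> \<pi> = \<pi> \<circ> \<tau>) \<longleftrightarrow> \<tau> = Hilbert_Choice.inv \<pi> \<circ> \<sigma> \<circ> \<pi>" if "\<pi> \<in> ?P" for \<pi>
    proof -
      have perm: "\<pi> permutes {..<n}" using that by (simp add: colour_perms_def)
      show ?thesis
        using permutes_inv_o[OF perm] by (metis comp_assoc comp_id id_comp)
    qed
    have "w \<sigma> \<tau> * of_nat (card {\<pi> \<in> ?P. \<sigma> \<circ> \<pi> = \<pi> \<circ> \<tau>}) = (\<Sum>\<pi> | \<pi> \<in> ?P \<and> \<sigma> \<circ> \<pi> = \<pi> \<circ> \<tau>. w \<sigma> \<tau>)"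
      by (simp only: sum_constant mult.commute)
    also have "\<dots> = (\<Sum>\<pi>\<in>?P. if \<sigma> \<circ> \<pi> = \<pi> \<circ> \<tau> then w \<sigma> \<tau> else 0)"
      by (intro sum.inter_filter finite_colour_perms)
    also have "\<dots> = (\<Sum>\<pi>\<in>?P. if \<tau> = Hilbert_Choice.inv \<pi> \<circ> \<sigma> \<circ> \<pi> then w \<sigma> \<tau> else 0)"
      by (intro sum.cong refl if_cong eq)
    finally show "w \<sigma> \<tau> * of_nat (card {\<pi> \<in> ?P. \<sigma> \<circ> \<pi> = \<pi> \<circ> \<tau>}) =
      (\<Sum>\<pi>\<in>?P. if \<tau> = Hilbert_Choice.inv \<pi> \<circ> \<sigma> \<circ> \<pi> then w \<sigma> \<tau> else 0)" .
  qed
  also have "\<dots> = (\<Sum>\<sigma>\<in>?S. \<Sum>\<pi>\<in>?P. \<Sum>\<tau>\<in>?S. if \<tau> = Hilbert_Choice.inv \<pi> \<circ> \<sigma> \<circ> \<pi> then w \<sigma> \<tau> else 0)"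
    by (intro sum.cong refl sum.swap)
  also have "\<dots> = (\<Sum>\<sigma>\<in>?S. \<Sum>\<pi>\<in>?P. p \<sigma> * cnj (q \<sigma>))"
  proof (intro sum.cong refl)
    fix \<sigma> \<pi> assume \<sigma>: "\<sigma> \<in> ?S" and \<pi>: "\<pi> \<in> ?P"
    then have perm: "\<sigma> permutes {..<n}" "\<pi> permutes {..<n}" by (auto simp: colour_perms_def)
    note inv = permutes_inv[OF perm(2)]
    let ?\<tau> = "Hilbert_Choice.inv \<pi> \<circ> \<sigma> \<circ> \<pi>"
    have mem: "?\<tau> \<in> ?S" using permutes_compose[OF perm(2) permutes_compose[OF perm(1) inv]] by (simp add: comp_assoc)
    have P: "permutation \<sigma>" "permutation \<pi>" "permutation (Hilbert_Choice.inv \<pi>)"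
      using perm inv permutation_permutes finite_lessThan by blast+
    have "sign ?\<tau> = sign \<sigma>"
      using P sign_idempotent[of \<pi>]
      by (simp only: sign_compose permutation_compose sign_inverse mult_ac) (simp add: mult.commute)
    moreover have "of_int (sign \<sigma>) * of_int (sign \<sigma>) = (1::complex)"
      by (simp only: of_int_mult[symmetric] sign_idempotent of_int_1)
    ultimately have "w \<sigma> ?\<tau> = p \<sigma> * cnj (q \<sigma>)"
      unfolding w_def using q[OF perm(1) \<pi>] by (simp only: mult_1_left)
    then show "(\<Sum>\<tau>\<in>?S. if \<tau> = ?\<tau> then w \<sigma> \<tau> else 0) = p \<sigma> * cnj (q \<sigma>)"
      by (simp only: sum.delta[OF fin] mem if_True)
  qed
  also have "\<dots> = of_nat (card ?P) * (\<Sum>\<sigma>\<in>?S. p \<sigma> * cnj (q \<sigma>))"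
    by (simp add: sum_distrib_left)
  finally show ?thesis by (simp only: w_def)
qed

lemma integral_trace_polys:
  assumes haar: "is_haar_unitary d \<mu>" and n: "(\<Sum>j<g. \<alpha> j) = n"
    and \<sigma>: "\<sigma> permutes {..<n}" and \<tau>: "\<tau> permutes {..<n}"
  shows "(LINT U|PiM {..<g} (\<lambda>_. \<mu>). trace_poly d g \<sigma> \<alpha> U * cnj (trace_poly d g \<tau> \<alpha> U)) =
    (\<Sum>a\<in>index_funs n d. \<Sum>c\<in>index_funs n d.
      joint_moment n g ((!) (colour_list g \<alpha>)) \<mu> (a \<circ> \<sigma>) (c \<circ> \<tau>) a c)"
proof -
  let ?W = "colour_word n ((!) (colour_list g \<alpha>))"
  have clr: "\<forall>t<n. colour_list g \<alpha> ! t < g"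
    using colour_list_less[of _ g \<alpha>] by (simp add: length_colour_list n)
  have "(LINT U|PiM {..<g} (\<lambda>_. \<mu>). trace_poly d g \<sigma> \<alpha> U * cnj (trace_poly d g \<tau> \<alpha> U)) =
    (LINT U|PiM {..<g} (\<lambda>_. \<mu>). (\<Sum>a\<in>index_funs n d. \<Sum>c\<in>index_funs n d.
       ?W U a (a \<circ> \<sigma>) * cnj (?W U c (c \<circ> \<tau>))))"
  proof (rule Bochner_Integration.integral_cong[OF refl])
    fix U assume "U \<in> space (PiM {..<g} (\<lambda>_. \<mu>))"
    then have U: "U j \<in> carrier_mat d d" if "j < g" for j
      using that space_haar[OF haar] by (auto simp: space_PiM intro: unitary_mats_carrier)
    show "trace_poly d g \<sigma> \<alpha> U * cnj (trace_poly d g \<tau> \<alpha> U) =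
      (\<Sum>a\<in>index_funs n d. \<Sum>c\<in>index_funs n d. ?W U a (a \<circ> \<sigma>) * cnj (?W U c (c \<circ> \<tau>)))"
      by (simp only: trace_poly_eq[OF U n \<sigma>] trace_poly_eq[OF U n \<tau>] cnj_sum sum_product)
  qed
  also have "\<dots> = (\<Sum>a\<in>index_funs n d. LINT U|PiM {..<g} (\<lambda>_. \<mu>). (\<Sum>c\<in>index_funs n d.
       ?W U a (a \<circ> \<sigma>) * cnj (?W U c (c \<circ> \<tau>))))"
    by (intro Bochner_Integration.integral_sum Bochner_Integration.integrable_sum
        integrable_colour_words[OF clr haar] index_funs_comp \<sigma> \<tau>)
  also have "\<dots> = (\<Sum>a\<in>index_funs n d. \<Sum>c\<in>index_funs n d.
      joint_moment n g ((!) (colour_list g \<alpha>)) \<mu> (a \<circ> \<sigma>) (c \<circ> \<tau>) a c)"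
    unfolding joint_moment_def
    by (intro sum.cong refl Bochner_Integration.integral_sum
        integrable_colour_words[OF clr haar] index_funs_comp \<sigma> \<tau>)
  finally show ?thesis .
qed

lemma integral_trace_polys_tendsto:
  assumes haar: "\<And>d. d \<ge> 1 \<Longrightarrow> is_haar_unitary d (haar d)" and n: "(\<Sum>j<g. \<alpha> j) = n"
    and \<sigma>: "\<sigma> permutes {..<n}" and \<tau>: "\<tau> permutes {..<n}"
  shows "(\<lambda>d. LINT U|PiM {..<g} (\<lambda>_. haar d). trace_poly d g \<sigma> \<alpha> U * cnj (trace_poly d g \<tau> \<alpha> U))
    \<longlonglongrightarrow> of_nat (card {\<pi> \<in> colour_perms n ((!) (colour_list g \<alpha>)). \<sigma> \<circ> \<pi> = \<pi> \<circ> \<tau>})"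
proof -
  let ?clr = "(!) (colour_list g \<alpha>)"
  define P where "P = colour_perms n ?clr"
  define I where "I d = (LINT U|PiM {..<g} (\<lambda>_. haar d). trace_poly d g \<sigma> \<alpha> U * cnj (trace_poly d g \<tau> \<alpha> U))" for d
  define L :: complex where "L = of_nat (card {\<pi> \<in> P. \<sigma> \<circ> \<pi> = \<pi> \<circ> \<tau>})"
  have clr: "\<forall>t<n. colour_list g \<alpha> ! t < g"
    using colour_list_less[of _ g \<alpha>] by (simp add: length_colour_list n)
  have "eventually (\<lambda>d. norm (I d - L) \<le> real (card P) * (2 * real (card P) + 1) / real d) sequentially"
    \<comment> \<open>These are the thresholds of \<open>joint_moment_cycle_sum_bound\<close>; the
      first also gives d \<ge> 1, as \<open>haar\<close> requires.\<close>
    using eventually_gt_at_top[of "4 * n"] eventually_ge_at_top[of "2 * card P"]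
  proof eventually_elim
    case (elim d)
    then have h: "is_haar_unitary d (haar d)" by (intro haar) simp
    show ?case
      unfolding I_def L_def integral_trace_polys[OF h n \<sigma> \<tau>] P_def
      using elim by (intro joint_moment_cycle_sum_bound[OF clr h \<sigma> \<tau>]) (simp_all add: P_def)
  qed
  moreover have "(\<lambda>d. real (card P) * (2 * real (card P) + 1) / real d) \<longlonglongrightarrow> 0"
    by (rule tendsto_divide_0[OF tendsto_const]) (rule filterlim_at_top_imp_at_infinity[OF filterlim_real_sequentially])
  ultimately have "(\<lambda>d. I d - L) \<longlonglongrightarrow> 0"
    by (rule Lim_null_comparison)
  then show ?thesis
    unfolding LIM_zero_iff by (simp only: I_def L_def P_def)
qed

theorem corollary3p4:
  fixes g k k' n :: nat
    and X Y :: "nat \<Rightarrow> complex mat"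
    and haar :: "nat \<Rightarrow> complex mat measure"
  assumes X: "\<And>j. j < g \<Longrightarrow> X j \<in> carrier_mat k k"
    and Y: "\<And>j. j < g \<Longrightarrow> Y j \<in> carrier_mat k' k'"
    and haar: "\<And>d. d \<ge> 1 \<Longrightarrow> is_haar_unitary d (haar d)"
  shows
    "(\<lambda>d. 1 / (fact n)\<^sup>2 *
        (\<Sum>\<alpha>\<in>multi_indices g n. (multinom g n \<alpha>)\<^sup>2 *
          (\<Sum>\<sigma>\<in>{\<sigma>. \<sigma> permutes {..<n}}. \<Sum>\<tau>\<in>{\<tau>. \<tau> permutes {..<n}}.
             of_int (sign \<sigma>) * of_int (sign \<tau>) *
             trace_poly k g \<sigma> \<alpha> X * cnj (trace_poly k' g \<tau> \<alpha> Y) *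
             (LINT U|PiM {..<g} (\<lambda>_. haar d).
                trace_poly d g \<sigma> \<alpha> U * cnj (trace_poly d g \<tau> \<alpha> U)))))
     \<longlonglongrightarrow>
     1 / fact n *
       (\<Sum>\<alpha>\<in>multi_indices g n. multinom g n \<alpha> *
         (\<Sum>\<sigma>\<in>{\<sigma>. \<sigma> permutes {..<n}}.
            trace_poly k g \<sigma> \<alpha> X * cnj (trace_poly k' g \<sigma> \<alpha> Y)))"
    (is "?lhs \<longlonglongrightarrow> ?rhs")
proof -
  let ?P = "\<lambda>\<alpha>. colour_perms n ((!) (colour_list g \<alpha>))"
  let ?S = "{\<sigma>. \<sigma> permutes {..<n}}"
  have n: "(\<Sum>j<g. \<alpha> j) = n" if "\<alpha> \<in> multi_indices g n" for \<alpha>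
    using that by (simp add: multi_indices_def)
  \<comment> \<open>All sums are over index sets that do not depend on d, so the limit is taken
    termwise.\<close>
  have "?lhs \<longlonglongrightarrow> 1 / (fact n)\<^sup>2 *
        (\<Sum>\<alpha>\<in>multi_indices g n. (multinom g n \<alpha>)\<^sup>2 *
          (\<Sum>\<sigma>\<in>?S. \<Sum>\<tau>\<in>?S.
             of_int (sign \<sigma>) * of_int (sign \<tau>) *
             trace_poly k g \<sigma> \<alpha> X * cnj (trace_poly k' g \<tau> \<alpha> Y) *
             of_nat (card {\<pi> \<in> ?P \<alpha>. \<sigma> \<circ> \<pi> = \<pi> \<circ> \<tau>})))"
    by (intro tendsto_mult tendsto_const tendsto_sum integral_trace_polys_tendsto haar n) simp_all
  also have "(\<Sum>\<alpha>\<in>multi_indices g n. (multinom g n \<alpha>)\<^sup>2 *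
          (\<Sum>\<sigma>\<in>?S. \<Sum>\<tau>\<in>?S.
             of_int (sign \<sigma>) * of_int (sign \<tau>) *
             trace_poly k g \<sigma> \<alpha> X * cnj (trace_poly k' g \<tau> \<alpha> Y) *
             of_nat (card {\<pi> \<in> ?P \<alpha>. \<sigma> \<circ> \<pi> = \<pi> \<circ> \<tau>}))) =
      (\<Sum>\<alpha>\<in>multi_indices g n. fact n * (multinom g n \<alpha> *
          (\<Sum>\<sigma>\<in>?S. trace_poly k g \<sigma> \<alpha> X * cnj (trace_poly k' g \<sigma> \<alpha> Y))))"
  proof (rule sum.cong[OF refl])
    fix \<alpha> assume \<alpha>: "\<alpha> \<in> multi_indices g n"
    let ?R = "\<Sum>\<sigma>\<in>?S. trace_poly k g \<sigma> \<alpha> X * cnj (trace_poly k' g \<sigma> \<alpha> Y)"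
    have "(\<Sum>\<sigma>\<in>?S. \<Sum>\<tau>\<in>?S. of_int (sign \<sigma>) * of_int (sign \<tau>) *
             trace_poly k g \<sigma> \<alpha> X * cnj (trace_poly k' g \<tau> \<alpha> Y) *
             of_nat (card {\<pi> \<in> ?P \<alpha>. \<sigma> \<circ> \<pi> = \<pi> \<circ> \<tau>})) = of_nat (card (?P \<alpha>)) * ?R"
      by (intro sum_conjugation_pairs trace_poly_conjugate Y) (simp_all add: n[OF \<alpha>])
    then have "(multinom g n \<alpha>)\<^sup>2 * (\<Sum>\<sigma>\<in>?S. \<Sum>\<tau>\<in>?S. of_int (sign \<sigma>) * of_int (sign \<tau>) *
             trace_poly k g \<sigma> \<alpha> X * cnj (trace_poly k' g \<tau> \<alpha> Y) *
             of_nat (card {\<pi> \<in> ?P \<alpha>. \<sigma> \<circ> \<pi> = \<pi> \<circ> \<tau>})) =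
        multinom g n \<alpha> * of_nat (card (?P \<alpha>)) * (multinom g n \<alpha> * ?R)"
      by (simp only: power2_eq_square mult_ac)
    \<comment> \<open>One of the two multinomial factors is absorbed by the order of P, and the
      resulting \<open>fact n\<close> later cancels against one of the two in the prefactor.\<close>
    also have "multinom g n \<alpha> * of_nat (card (?P \<alpha>)) = fact n"
      by (rule multinom_times_card_colour_perms[OF \<alpha>])
    finally show "(multinom g n \<alpha>)\<^sup>2 * (\<Sum>\<sigma>\<in>?S. \<Sum>\<tau>\<in>?S. of_int (sign \<sigma>) * of_int (sign \<tau>) *
             trace_poly k g \<sigma> \<alpha> X * cnj (trace_poly k' g \<tau> \<alpha> Y) *
             of_nat (card {\<pi> \<in> ?P \<alpha>. \<sigma> \<circ> \<pi> = \<pi> \<circ> \<tau>})) = fact n * (multinom g n \<alpha> * ?R)" .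
  qed
  also have "1 / (fact n)\<^sup>2 * \<dots> = ?rhs"
    unfolding sum_distrib_left[symmetric] by (simp add: power2_eq_square)
  finally show ?thesis .
qed

end
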